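(* Let $K$ be an infinite compact subset of $\mathbb R^d$. Then a typical $\mu\in\mathcal P(K)$ satisfies $\underline D_\mu(+\infty)=0$, $\overline D_\mu(+\infty)=\overline{\dim}_{B,{\rm loc},{\rm unif}}(K)$, $\underline D_\mu(-\infty)=\underline{\dim}_B(K)$ and $\overline D_\mu(-\infty)=+\infty$.
   Context: $\mathcal P(K)$ is the set of Borel probability measures on $K$ with the weak topology; "typical" means holding on a set containing a dense $G_\delta$ subset. $B(x,r)$ is the open ball. For $\mu\in\mathcal P(K)$: $\overline D_\mu(-\infty)=\limsup_{r\to0}\frac{\log\inf_{x\in\operatorname{supp}\mu}\mu(B(x,r))}{\log r}$, $\underline D_\mu(-\infty)$ the same with $\liminf$; $\overline D_\mu(+\infty)=\limsup_{r\to0}\frac{\log\sup_{x\in\operatorname{supp}\mu}\mu(B(x,r))}{\log r}$, $\underline D_\mu(+\infty)$ the same with $\liminf$. $\mathbf N_r(E)$ is the smallest number of balls of radius $r$ covering $E$; $\overline{\dim}_{B,{\rm loc},{\rm unif}}(K)=\inf_{N\ge1}\inf_{x_1,\dots,x_N\in K}\inf_{r_0>0}\limsup_{r\to0}\min_{1\le i\le N}\frac{\log\mathbf N_r(K\cap B(x_i,r_0))}{-\log r}$. $\underline{\dim}_B$ is the lower box dimension. *)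

theory Defs
  imports "HOL-Analysis.Analysis" "HOL-Probability.Probability"
begin

definition prob_measures_on :: "'a::euclidean_space set \<Rightarrow> 'a measure set" where
  "prob_measures_on K =
     {\<mu>. prob_space \<mu> \<and> sets \<mu> = sets borel \<and> emeasure \<mu> K = 1}"

definition weak_topology :: "'a::euclidean_space set \<Rightarrow> 'a measure topology" where
  "weak_topology K = topology_generated_by
     {{\<mu> \<in> prob_measures_on K. (\<integral>x. f x \<partial>\<mu>) \<in> U} | f U.
        continuous_on UNIV f \<and> bounded (range f) \<and> open (U :: real set)}"

definition typical :: "'a topology \<Rightarrow> ('a \<Rightarrow> bool) \<Rightarrow> bool" where
  "typical X P \<longleftrightarrow> (\<exists>G. gdelta_in X G \<and> X closure_of G = topspace X \<and> (\<forall>\<mu>\<in>G. P \<mu>))"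

definition msupp :: "'a::metric_space measure \<Rightarrow> 'a set" where
  "msupp \<mu> = {x. \<forall>r>0. emeasure \<mu> (ball x r) > 0}"

definition lower_Dminus :: "'a::euclidean_space measure \<Rightarrow> ereal" where
  "lower_Dminus \<mu> = Liminf (at_right 0)
     (\<lambda>r. ereal (ln (INF x\<in>msupp \<mu>. measure \<mu> (ball x r)) / ln r))"

definition upper_Dminus :: "'a::euclidean_space measure \<Rightarrow> ereal" where
  "upper_Dminus \<mu> = Limsup (at_right 0)
     (\<lambda>r. ereal (ln (INF x\<in>msupp \<mu>. measure \<mu> (ball x r)) / ln r))"

definition lower_Dplus :: "'a::euclidean_space measure \<Rightarrow> ereal" where
  "lower_Dplus \<mu> = Liminf (at_right 0)
     (\<lambda>r. ereal (ln (SUP x\<in>msupp \<mu>. measure \<mu> (ball x r)) / ln r))"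

definition upper_Dplus :: "'a::euclidean_space measure \<Rightarrow> ereal" where
  "upper_Dplus \<mu> = Limsup (at_right 0)
     (\<lambda>r. ereal (ln (SUP x\<in>msupp \<mu>. measure \<mu> (ball x r)) / ln r))"

definition covering_number :: "'a::metric_space set \<Rightarrow> real \<Rightarrow> nat" where
  "covering_number E r = (LEAST n. \<exists>C. finite C \<and> card C = n \<and> E \<subseteq> (\<Union>x\<in>C. ball x r))"

definition lower_box_dim :: "'a::metric_space set \<Rightarrow> ereal" where
  "lower_box_dim E = Liminf (at_right 0)
     (\<lambda>r. ereal (ln (real (covering_number E r)) / - ln r))"

definition upper_box_dim_loc_unif :: "'a::metric_space set \<Rightarrow> ereal" where
  "upper_box_dim_loc_unif K =
     (INF xs\<in>{xs. xs \<noteq> [] \<and> set xs \<subseteq> K}. INF r0\<in>{0<..}.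
        Limsup (at_right 0) (\<lambda>r. Min ((\<lambda>i. ereal (ln (real (covering_number (K \<inter> ball (xs ! i) r0) r)) / - ln r))
                                        ` {..<length xs})))"

end

(* The weak topology on P(K) is handled through the law map X \<mapsto> law X from K-valued random
   variables on [0,1], which is continuous for the L1 distance.  That distance is complete, so a
   nested-ball argument gives a Baire theorem for P(K), provided density of each open set can be
   tested on step maps by L1-small refinements.

   The four equalities come from countably many open conditions.  Every measure of full support
   satisfies upper D(+oo) \<le> dim_loc,unif (pigeonhole over a cover of K \<inter> B(x_i,r0)) and
   lower D(-oo) \<ge> lower box dimension (disjoint balls around a separated set).  For the converse
   bounds one perturbs a step map: nothing is needed for a heavy atom; a new very light atom makes
   some ball tiny; spreading each atom over a separated set of equal cardinality near it makes all
   balls small at some scale; adding uniform mass on an optimal net makes all balls large. *)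
theory Submission
  imports Defs
begin

subsection \<open>The weak topology\<close>

text \<open>Equal weights are what ties the construction together. The law of a step map is an
  average of \<open>M\<close> point masses of weight 1/M; a refinement cuts every step into the same
  number \<open>n\<close> of pieces and moves them separately, so the weights stay equal and only
  the average displacement must be small. Either a small share of the pieces may cross all of
  \<open>K\<close>, or all of them may move by a little.

  This is also where the local uniform dimension comes from. The values of a step map are a finite
  list of points of \<open>K\<close>, and equal weights ask for the same number of separated points
  near each of them, at the same scale. The minimum over the list says how many such points are
  available simultaneously.

  A condition on all balls of one radius is tested on the centres of a finite net, since finitely
  many open conditions have an open intersection. Passing from a centre to a nearby point costs a
  factor 2 in the radius. This factor and all other constants disappear because powers of the radius
  are compared at strictly different exponents.\<close>

lemma prob_measures_onD:
  assumes "\<mu> \<in> prob_measures_on K"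
  shows "prob_space \<mu>" "sets \<mu> = sets borel" "space \<mu> = UNIV" "emeasure \<mu> K = 1"
  using assms sets_eq_imp_space_eq[of \<mu> borel] by (auto simp: prob_measures_on_def)

lemma topspace_weak_topology [simp]: "topspace (weak_topology K) = prob_measures_on K"
proof -
  have "prob_measures_on K \<in> {{\<mu> \<in> prob_measures_on K. (\<integral>x. f x \<partial>\<mu>) \<in> U} | f U.
        continuous_on UNIV f \<and> bounded (range f) \<and> open (U :: real set)}"
    by (intro CollectI exI[of _ "\<lambda>_. 0"] exI[of _ UNIV]) auto
  then show ?thesis
    unfolding weak_topology_def by auto
qed

lemma openin_weak_topology_integral:
  fixes f :: "'a::euclidean_space \<Rightarrow> real"
  assumes "continuous_on UNIV f" "bounded (range f)" "open U"
  shows "openin (weak_topology K) {\<mu> \<in> prob_measures_on K. (\<integral>x. f x \<partial>\<mu>) \<in> U}"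
  unfolding weak_topology_def openin_topology_generated_by_iff
  by (rule generate_topology_on.Basis, rule CollectI, rule exI[of _ f], rule exI[of _ U]) (simp add: assms)

definition weak_nbhd :: "'a::euclidean_space set \<Rightarrow> 'a measure \<Rightarrow> ('a \<Rightarrow> real) set \<Rightarrow> real \<Rightarrow> 'a measure set" where
  "weak_nbhd K \<mu> F e = {\<nu> \<in> prob_measures_on K. \<forall>f\<in>F. \<bar>(\<integral>x. f x \<partial>\<nu>) - (\<integral>x. f x \<partial>\<mu>)\<bar> < e}"

definition test_functions :: "('a::euclidean_space \<Rightarrow> real) set" where
  "test_functions = {f. continuous_on UNIV f \<and> bounded (range f)}"

text \<open>Induction over the generation of the topology turns the subbasis into neighbourhoods
  given by finitely many test functions and one tolerance. Finiteness is what allows a minimum of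
  moduli in \<open>law_continuous\<close> and a single sample in
  \<open>law_of_large_numbers_sample\<close>.\<close>

lemma openin_weak_topologyD:
  assumes "openin (weak_topology K) V" "\<mu> \<in> V"
  shows "\<exists>F e. finite F \<and> e > 0 \<and> F \<subseteq> test_functions \<and> weak_nbhd K \<mu> F e \<subseteq> V"
    (is "?N V \<mu>")
proof -
  have "generate_topology_on {{\<mu> \<in> prob_measures_on K. (\<integral>x. f x \<partial>\<mu>) \<in> U} | f U.
        continuous_on UNIV f \<and> bounded (range f) \<and> open (U :: real set)} V"
    using assms(1) by (simp add: weak_topology_def openin_topology_generated_by_iff)
  then have "\<forall>\<mu>\<in>V. ?N V \<mu>"
  proof induction
    case Empty
    then show ?case by simp
  next
    case (Int A B)
    show ?case
    proof
      fix \<mu> assume "\<mu> \<in> A \<inter> B"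
      with Int.IH have "?N A \<mu>" "?N B \<mu>" by auto
      from this(1) obtain F d where F: "finite F" "d > 0" "F \<subseteq> test_functions" "weak_nbhd K \<mu> F d \<subseteq> A"
        by blast
      from \<open>?N B \<mu>\<close> obtain G e where G: "finite G" "e > 0" "G \<subseteq> test_functions" "weak_nbhd K \<mu> G e \<subseteq> B"
        by blast
      have "weak_nbhd K \<mu> (F \<union> G) (min d e) \<subseteq> weak_nbhd K \<mu> F d \<inter> weak_nbhd K \<mu> G e"
        by (auto simp: weak_nbhd_def)
      with F G show "?N (A \<inter> B) \<mu>"
        by (intro exI[of _ "F \<union> G"] exI[of _ "min d e"]) auto
    qed
  next
    case (UN \<K>)
    show ?case
    proof
      fix \<mu> assume "\<mu> \<in> \<Union> \<K>"
      then obtain V where V: "V \<in> \<K>" "\<mu> \<in> V" by auto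
      with UN.IH have "?N V \<mu>" by auto
      then show "?N (\<Union> \<K>) \<mu>" using V by (meson Union_upper subset_trans)
    qed
  next
    case (Basis s)
    then obtain f and U :: "real set" where fU: "s = {\<mu> \<in> prob_measures_on K. (\<integral>x. f x \<partial>\<mu>) \<in> U}"
      "continuous_on UNIV f" "bounded (range f)" "open U" by auto
    show ?case
    proof
      fix \<mu> assume "\<mu> \<in> s"
      then obtain e where "e > 0" "\<And>y. \<bar>y - (\<integral>x. f x \<partial>\<mu>)\<bar> < e \<Longrightarrow> y \<in> U"
        using fU(1,4) by (auto simp: open_dist dist_real_def)
      then show "?N s \<mu>"
        using fU by (intro exI[of _ "{f}"] exI[of _ e]) (auto simp: test_functions_def weak_nbhd_def)
    qed
  qed
  then show ?thesis using assms(2) by (rule bspec)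
qed

text \<open>The mass of an open set is the supremum of the integrals of continuous functions below
  its indicator: inner regularity finds a compact subset of nearly full mass, and Urysohn puts such
  a function above its indicator. The set is therefore a union of subbasic open sets.\<close>

lemma openin_weak_topology_measure_gt:
  fixes K U :: "'a::euclidean_space set"
  assumes "open U"
  shows "openin (weak_topology K) {\<mu> \<in> prob_measures_on K. c < measure \<mu> U}"
proof -
  define F where "F = {f. continuous_on UNIV f \<and> (\<forall>x. 0 \<le> f x \<and> f x \<le> (indicator U x :: real))}"
  have F1: "\<bar>f x\<bar> \<le> 1" if "f \<in> F" for f x
  proof -
    have "0 \<le> f x" "f x \<le> indicator U x" using that by (auto simp: F_def)
    moreover have "(indicator U x :: real) \<le> 1" by (simp add: indicator_def)
    ultimately show ?thesis by linarith
  qed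
  have bdd: "bounded (range f)" if "f \<in> F" for f
    using F1[OF that] by (auto simp: bounded_iff)
  have "{\<mu> \<in> prob_measures_on K. c < measure \<mu> U} =
        (\<Union>f\<in>F. {\<mu> \<in> prob_measures_on K. (\<integral>x. f x \<partial>\<mu>) \<in> {c<..}})" (is "?L = ?R")
  proof
    show "?R \<subseteq> ?L"
    proof (clarsimp)
      fix f \<mu> assume f: "f \<in> F" and \<mu>: "\<mu> \<in> prob_measures_on K" and c: "c < (\<integral>x. f x \<partial>\<mu>)"
      interpret prob_space \<mu> using prob_measures_onD[OF \<mu>] by simp
      note [measurable_cong] = prob_measures_onD(2)[OF \<mu>]
      have [measurable]: "f \<in> borel_measurable borel" "U \<in> sets borel"
        using f assms by (auto simp: F_def borel_measurable_continuous_onI)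
      have "(\<integral>x. f x \<partial>\<mu>) \<le> (\<integral>x. indicator U x \<partial>\<mu>)"
      proof (rule integral_mono)
        show "integrable \<mu> f"
          using F1[OF f] by (intro integrable_const_bound[of _ 1]) auto
      qed (use f in \<open>auto simp: F_def less_top[symmetric]\<close>)
      with c show "c < measure \<mu> U" using prob_measures_onD(3)[OF \<mu>] by simp
    qed
    show "?L \<subseteq> ?R"
    proof (clarsimp)
      fix \<mu> assume \<mu>: "\<mu> \<in> prob_measures_on K" and c: "c < measure \<mu> U"
      interpret prob_space \<mu> using prob_measures_onD[OF \<mu>] by simp
      note [simp, measurable_cong] = prob_measures_onD(2)[OF \<mu>]
      note [simp] = prob_measures_onD(3)[OF \<mu>]
      have "\<exists>C. C \<subseteq> U \<and> compact C \<and> c < measure \<mu> C"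
      \<comment> \<open>Inner regularity is a statement about \<open>emeasure\<close>, where a
        negative \<open>c\<close> has no faithful image. For such \<open>c\<close> the empty set is
        already a witness.\<close>
      proof (cases "c < 0")
        case True
        then show ?thesis by (intro exI[of _ "{}"]) auto
      next
        case False
        have "ennreal c < emeasure \<mu> U"
          using c False by (simp add: emeasure_eq_measure ennreal_lessI)
        also have "emeasure \<mu> U = (SUP C\<in>{C. C \<subseteq> U \<and> compact C}. emeasure \<mu> C)"
          using assms by (intro inner_regular) auto
        finally show ?thesis
          using False by (auto simp: less_SUP_iff emeasure_eq_measure ennreal_less_iff)
      qed
      then obtain C where C: "C \<subseteq> U" "compact C" "c < measure \<mu> C" by blast
      obtain f :: "'a \<Rightarrow> real" where f: "continuous_on UNIV f" "\<And>x. f x \<in> closed_segment 1 0"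
         "\<And>x. x \<in> C \<Longrightarrow> f x = 1" "\<And>x. x \<in> - U \<Longrightarrow> f x = 0"
        by (rule Urysohn[of C "- U" "1::real" 0]) (use C assms in \<open>auto intro: compact_imp_closed\<close>)
      have f01: "0 \<le> f x \<and> f x \<le> 1" for x
        using f(2)[of x] by (auto simp: closed_segment_eq_real_ivl)
      have fF: "f \<in> F"
        using f f01 by (auto simp: F_def indicator_def)
      have [measurable]: "f \<in> borel_measurable borel" "C \<in> sets borel"
        using f C by (auto simp: borel_measurable_continuous_onI borel_compact)
      have "measure \<mu> C = (\<integral>x. indicator C x \<partial>\<mu>)" by simp
      also have "\<dots> \<le> (\<integral>x. f x \<partial>\<mu>)"
      proof (rule integral_mono)
        show "integrable \<mu> f"
          using f01 by (intro integrable_const_bound[of _ 1]) auto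
        show "integrable \<mu> (indicator C :: 'a \<Rightarrow> real)"
          by (simp add: less_top[symmetric])
        show "indicator C x \<le> f x" for x
          using f(3)[of x] f01[of x] by (cases "x \<in> C") auto
      qed
      finally show "\<exists>f\<in>F. c < (\<integral>x. f x \<partial>\<mu>)"
        using C fF by force
    qed
  qed
  also have "openin (weak_topology K) \<dots>"
  proof (rule openin_Union)
    fix S assume "S \<in> (\<lambda>f. {\<mu> \<in> prob_measures_on K. (\<integral>x. f x \<partial>\<mu>) \<in> {c<..}}) ` F"
    then obtain f where f: "f \<in> F" and S: "S = {\<mu> \<in> prob_measures_on K. (\<integral>x. f x \<partial>\<mu>) \<in> {c<..}}"
      by blast
    show "openin (weak_topology K) S"
      unfolding S using f bdd[OF f] by (intro openin_weak_topology_integral) (auto simp: F_def)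
  qed
  finally show ?thesis .
qed

lemma openin_weak_topology_measure_lt:
  fixes K C :: "'a::euclidean_space set"
  assumes "closed C"
  shows "openin (weak_topology K) {\<mu> \<in> prob_measures_on K. measure \<mu> C < c}"
proof -
  have "measure \<mu> C < c \<longleftrightarrow> 1 - c < measure \<mu> (- C)" if "\<mu> \<in> prob_measures_on K" for \<mu>
  proof -
    note \<mu> = prob_measures_onD[OF that]
    interpret prob_space \<mu> by fact
    show ?thesis using prob_compl[of C] \<mu> assms by (auto simp: Compl_eq_Diff_UNIV)
  qed
  then have "{\<mu> \<in> prob_measures_on K. measure \<mu> C < c} = {\<mu> \<in> prob_measures_on K. 1 - c < measure \<mu> (- C)}"
    by auto
  then show ?thesis
    using openin_weak_topology_measure_gt[of "- C" K "1 - c"] assms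
    by (simp only: open_Compl)
qed

subsection \<open>Step maps on the unit interval and the L1 distance\<close>

text \<open>The measure lives on the whole line, so random variables are total functions and
  \<open>range X \<subseteq> K\<close> can be asked everywhere. The half-open interval is
  partitioned exactly by the \<open>M\<close> cells of a step map.\<close>

definition unit_prob :: "real measure" where
  "unit_prob = uniform_measure lborel {0..<1}"

text \<open>The value is \<open>h k\<close> on the cell [k/M, (k+1)/M). Repetitions in
  \<open>h\<close> are allowed, and they are how atoms of different mass are encoded with cells of
  equal length.\<close>

definition step :: "nat \<Rightarrow> (nat \<Rightarrow> 'a) \<Rightarrow> real \<Rightarrow> 'a" where
  "step M h \<omega> = h (nat \<lfloor>real M * \<omega>\<rfloor>)"

definition L1_dist :: "(real \<Rightarrow> 'a::euclidean_space) \<Rightarrow> (real \<Rightarrow> 'a) \<Rightarrow> real" where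
  "L1_dist X Y = (\<integral>\<omega>. norm (X \<omega> - Y \<omega>) \<partial>unit_prob)"

definition rvs :: "'a::euclidean_space set \<Rightarrow> (real \<Rightarrow> 'a) set" where
  "rvs K = {X \<in> borel_measurable unit_prob. range X \<subseteq> K}"

abbreviation law :: "(real \<Rightarrow> 'a::euclidean_space) \<Rightarrow> 'a measure" where
  "law X \<equiv> distr unit_prob borel X"

lemma sets_unit_prob [simp, measurable_cong]: "sets unit_prob = sets borel"
  and space_unit_prob [simp]: "space unit_prob = UNIV"
  by (auto simp: unit_prob_def)

lemma prob_space_unit_prob: "prob_space unit_prob"
  unfolding unit_prob_def by (intro prob_space_uniform_measure) auto

interpretation unit_prob: prob_space unit_prob
  by (fact prob_space_unit_prob)

lemma borel_measurable_step [measurable]: "step M h \<in> borel_measurable unit_prob"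
proof -
  have "(\<lambda>\<omega>. nat \<lfloor>real M * \<omega>\<rfloor>) \<in> unit_prob \<rightarrow>\<^sub>M count_space UNIV"
    by measurable
  then have "(\<lambda>\<omega>. h (nat \<lfloor>real M * \<omega>\<rfloor>)) \<in> borel_measurable unit_prob"
    by (rule measurable_compose) simp
  then show ?thesis by (simp add: step_def[abs_def])
qed

lemma step_comp: "g (step M h \<omega>) = step M (\<lambda>k. g (h k)) \<omega>"
  by (simp add: step_def)

lemma integral_step:
  fixes g :: "nat \<Rightarrow> real"
  assumes "M > 0"
  shows "(\<integral>\<omega>. step M g \<omega> \<partial>unit_prob) = (\<Sum>k<M. g k) / real M"
proof -
  define I where "I k = {real k / real M..<(real k + 1) / real M}" for k
  have eq: "step M g \<omega> = (\<Sum>k<M. g k * indicator (I k) \<omega>)" if "\<omega> \<in> {0..<1}" for \<omega>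
  proof -
    define j where "j = nat \<lfloor>real M * \<omega>\<rfloor>"
    have "real M * \<omega> < real M" using that assms by simp
    then have j: "j < M" using that unfolding j_def by (simp add: nat_less_iff floor_less_iff)
    have "\<omega> \<in> I k \<longleftrightarrow> k = j" for k
    proof -
      have "\<omega> \<in> I k \<longleftrightarrow> real k \<le> real M * \<omega> \<and> real M * \<omega> < real k + 1"
        using assms by (simp add: I_def field_simps)
      also have "\<dots> \<longleftrightarrow> \<lfloor>real M * \<omega>\<rfloor> = int k" by (simp add: floor_eq_iff)
      also have "\<dots> \<longleftrightarrow> k = j" using that by (auto simp: j_def)
      finally show ?thesis .
    qed
    then have "(\<Sum>k<M. g k * indicator (I k) \<omega>) = (\<Sum>k<M. if k = j then g k else 0)"
      by (intro sum.cong) (auto simp: indicator_def)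
    also have "\<dots> = g j" using j by simp
    finally show ?thesis by (simp add: step_def j_def)
  qed
  have "(\<integral>\<omega>. step M g \<omega> \<partial>unit_prob) = (\<integral>\<omega>. (\<Sum>k<M. g k * indicator (I k) \<omega>) \<partial>unit_prob)"
  proof (rule integral_cong_AE)
    show "(\<lambda>\<omega>. \<Sum>k<M. g k * indicator (I k) \<omega>) \<in> borel_measurable unit_prob"
      unfolding I_def by measurable
    show "AE \<omega> in unit_prob. step M g \<omega> = (\<Sum>k<M. g k * indicator (I k) \<omega>)"
      using eq unfolding unit_prob_def by (intro AE_uniform_measureI) auto
  qed simp
  also have "\<dots> = (\<Sum>k<M. g k * measure unit_prob (I k))"
    by (subst Bochner_Integration.integral_sum)
       (auto simp: I_def less_top[symmetric])
  also have "\<dots> = (\<Sum>k<M. g k / real M)"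
  proof (intro sum.cong refl)
    fix k assume "k \<in> {..<M}"
    then have "real k + 1 \<le> real M" by auto
    then have "(real k + 1) / real M \<le> 1" using assms by simp
    then have "{0..<1} \<inter> I k = I k" using assms by (auto simp: I_def intro: order_trans[rotated])
    moreover have "measure lborel (I k) = 1 / real M"
      using assms by (simp add: I_def diff_divide_distrib[symmetric] field_simps)
    ultimately show "g k * measure unit_prob (I k) = g k / real M"
      unfolding unit_prob_def by (subst measure_uniform_measure) (auto simp: I_def)
  qed
  finally show ?thesis by (simp add: sum_divide_distrib)
qed

lemma integral_law_step:
  fixes f :: "'a::euclidean_space \<Rightarrow> real"
  assumes "M > 0" "f \<in> borel_measurable borel"
  shows "(\<integral>x. f x \<partial>law (step M h)) = (\<Sum>k<M. f (h k)) / real M"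
  using assms by (simp add: integral_distr step_comp[of f] integral_step)

text \<open>The floor of M * n * \<omega>, divided by \<open>n\<close> with remainder, is the floor
  of M * \<omega>. This puts two step maps on a common partition, where their distance is a finite
  sum.\<close>

lemma step_refine:
  assumes "n > 0"
  shows "step M h = step (M * n) (\<lambda>q. h (q div n))"
proof
  fix \<omega>
  have "\<lfloor>real M * \<omega>\<rfloor> = \<lfloor>real (M * n) * \<omega>\<rfloor> div int n"
    using floor_divide_real_eq_div[of "int n" "real (M * n) * \<omega>"] assms by simp
  then have "nat \<lfloor>real M * \<omega>\<rfloor> = nat \<lfloor>real (M * n) * \<omega>\<rfloor> div n"
    by (metis nat_div_distrib' nat_int of_nat_0_le_iff)
  then show "step M h \<omega> = step (M * n) (\<lambda>q. h (q div n)) \<omega>"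
    by (simp add: step_def)
qed

lemma L1_dist_step_refine:
  assumes "M > 0" "n > 0"
  shows "L1_dist (step M h) (step (M * n) h') = (\<Sum>q<M * n. norm (h (q div n) - h' q)) / real (M * n)"
proof -
  have "norm (step M h \<omega> - step (M * n) h' \<omega>) = step (M * n) (\<lambda>q. norm (h (q div n) - h' q)) \<omega>" for \<omega>
    by (subst step_refine[OF assms(2)]) (simp add: step_def)
  then show ?thesis
    unfolding L1_dist_def using assms by (simp add: integral_step)
qed

lemma step_in_rvs: "range h \<subseteq> K \<Longrightarrow> step M h \<in> rvs K"
  by (auto simp: rvs_def step_def)

lemma law_in_prob_measures_on:
  assumes "closed K" "X \<in> rvs K"
  shows "law X \<in> prob_measures_on K"
proof -
  have [measurable]: "X \<in> borel_measurable unit_prob" "K \<in> sets borel"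
    using assms by (auto simp: rvs_def)
  have "X -` K = UNIV" using assms by (auto simp: rvs_def)
  then show ?thesis
    unfolding prob_measures_on_def
    using unit_prob.emeasure_space_1 by (auto simp: emeasure_distr intro!: unit_prob.prob_space_distr)
qed

lemma integrable_norm_diff_rvs:
  assumes "bounded K" "X \<in> rvs K" "Y \<in> rvs K"
  shows "integrable unit_prob (\<lambda>\<omega>. norm (X \<omega> - Y \<omega>))"
proof -
  have [measurable]: "X \<in> borel_measurable unit_prob" "Y \<in> borel_measurable unit_prob"
    using assms by (auto simp: rvs_def)
  obtain B where "\<And>x. x \<in> K \<Longrightarrow> norm x \<le> B" using assms(1) by (auto simp: bounded_iff)
  then have "norm (X \<omega>) \<le> B" "norm (Y \<omega>) \<le> B" for \<omega>
    using assms unfolding rvs_def by blast+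
  then have "norm (X \<omega> - Y \<omega>) \<le> B + B" for \<omega>
    by (rule order_trans[OF norm_triangle_ineq4 add_mono])
  then show ?thesis
    by (intro unit_prob.integrable_const_bound[of _ "B + B"]) auto
qed

lemma L1_dist_triangle:
  assumes "bounded K" "X \<in> rvs K" "Y \<in> rvs K" "Z \<in> rvs K"
  shows "L1_dist X Z \<le> L1_dist X Y + L1_dist Y Z"
proof -
  note int = integrable_norm_diff_rvs[OF assms(1)]
  have "L1_dist X Z \<le> (\<integral>\<omega>. norm (X \<omega> - Y \<omega>) + norm (Y \<omega> - Z \<omega>) \<partial>unit_prob)"
    unfolding L1_dist_def
  proof (intro integral_mono Bochner_Integration.integrable_add int assms)
    show "norm (X \<omega> - Z \<omega>) \<le> norm (X \<omega> - Y \<omega>) + norm (Y \<omega> - Z \<omega>)" for \<omega>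
      using norm_triangle_ineq[of "X \<omega> - Y \<omega>" "Y \<omega> - Z \<omega>"] by simp
  qed
  then show ?thesis
    unfolding L1_dist_def using int assms by simp
qed

text \<open>Uniform continuity on \<open>K\<close> becomes an affine modulus: below distance
  \<delta> the function varies by at most e/2, and from \<delta> on the linear term 2B/\<delta>
  times the distance exceeds the trivial bound 2B. Such a modulus can be integrated directly against
  the L1 distance.\<close>

lemma law_continuous_function:
  fixes K :: "'a::euclidean_space set" and f :: "'a \<Rightarrow> real"
  assumes K: "compact K" and f: "continuous_on UNIV f" "bounded (range f)" and X: "X \<in> rvs K" and e: "e > 0"
  shows "\<exists>d>0. \<forall>Y\<in>rvs K. L1_dist X Y \<le> d \<longrightarrow> \<bar>(\<integral>x. f x \<partial>law Y) - (\<integral>x. f x \<partial>law X)\<bar> < e"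
proof -
  obtain B where B: "B > 0" "\<And>x. \<bar>f x\<bar> \<le> B" using f(2) by (auto simp: bounded_pos)
  have "uniformly_continuous_on K f"
    using K f by (intro compact_uniformly_continuous) (auto intro: continuous_on_subset)
  then obtain \<delta> where \<delta>: "\<delta> > 0" "\<And>x y. x \<in> K \<Longrightarrow> y \<in> K \<Longrightarrow> dist y x < \<delta> \<Longrightarrow> dist (f y) (f x) < e / 2"
    unfolding uniformly_continuous_on_def using half_gt_zero[OF e] by metis
  have mod: "\<bar>f y - f x\<bar> \<le> e / 2 + 2 * B / \<delta> * norm (x - y)" if "x \<in> K" "y \<in> K" for x y
  proof (cases "dist y x < \<delta>")
    case True
    then have "\<bar>f y - f x\<bar> < e / 2" using \<delta>(2)[OF that] by (simp add: dist_real_def)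
    then show ?thesis using B \<delta>(1) by (smt (verit) divide_nonneg_pos mult_nonneg_nonneg norm_ge_zero)
  next
    case False
    then have "1 \<le> norm (x - y) / \<delta>" using \<delta>(1) by (simp add: dist_norm norm_minus_commute)
    then have "2 * B * 1 \<le> 2 * B * (norm (x - y) / \<delta>)" using B by (intro mult_left_mono) auto
    moreover have "\<bar>f y - f x\<bar> \<le> 2 * B" using B(2)[of x] B(2)[of y] by linarith
    ultimately show ?thesis using e by simp
  qed
  have [measurable]: "f \<in> borel_measurable borel" using f by (simp add: borel_measurable_continuous_onI)
  have int: "integrable unit_prob (\<lambda>\<omega>. f (Y \<omega>))" if "Y \<in> rvs K" for Y
  proof -
    have [measurable]: "Y \<in> borel_measurable unit_prob" using that by (simp add: rvs_def)
    show ?thesis using B by (intro unit_prob.integrable_const_bound[of _ B]) auto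
  qed
  \<comment> \<open>With this choice the linear term contributes at most e/4, on top of the e/2 from
    uniform continuity.\<close>
  define d where "d = e * \<delta> / (8 * B)"
  have "d > 0" using e \<delta> B by (simp add: d_def)
  moreover have "\<bar>(\<integral>x. f x \<partial>law Y) - (\<integral>x. f x \<partial>law X)\<bar> < e" if Y: "Y \<in> rvs K" "L1_dist X Y \<le> d" for Y
  proof -
    have [measurable]: "Y \<in> borel_measurable unit_prob" "X \<in> borel_measurable unit_prob"
      using X Y by (auto simp: rvs_def)
    have "\<bar>(\<integral>x. f x \<partial>law Y) - (\<integral>x. f x \<partial>law X)\<bar> = \<bar>\<integral>\<omega>. f (Y \<omega>) - f (X \<omega>) \<partial>unit_prob\<bar>"
      using int X Y by (simp add: integral_distr)
    also have "\<dots> \<le> (\<integral>\<omega>. \<bar>f (Y \<omega>) - f (X \<omega>)\<bar> \<partial>unit_prob)"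
      by (rule integral_abs_bound)
    also have "\<dots> \<le> (\<integral>\<omega>. e / 2 + 2 * B / \<delta> * norm (X \<omega> - Y \<omega>) \<partial>unit_prob)"
    proof (rule integral_mono)
      show "integrable unit_prob (\<lambda>\<omega>. \<bar>f (Y \<omega>) - f (X \<omega>)\<bar>)"
        using int X Y by auto
      show "integrable unit_prob (\<lambda>\<omega>. e / 2 + 2 * B / \<delta> * norm (X \<omega> - Y \<omega>))"
        using integrable_norm_diff_rvs[OF compact_imp_bounded[OF K] X Y(1)] by simp
      show "\<bar>f (Y \<omega>) - f (X \<omega>)\<bar> \<le> e / 2 + 2 * B / \<delta> * norm (X \<omega> - Y \<omega>)" for \<omega>
        using X Y by (intro mod) (auto simp: rvs_def)
    qed
    also have "\<dots> = e / 2 + 2 * B / \<delta> * L1_dist X Y"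
      using integrable_norm_diff_rvs[OF compact_imp_bounded[OF K] X Y(1)]
      by (simp add: L1_dist_def unit_prob.prob_space[simplified])
    also have "\<dots> \<le> e / 2 + 2 * B / \<delta> * d"
      using Y B \<delta> by (intro add_left_mono mult_left_mono) auto
    also have "\<dots> < e" using B \<delta> e by (simp add: d_def)
    finally show ?thesis .
  qed
  ultimately show ?thesis by blast
qed

text \<open>The neighbourhood is a closed L1 ball, because membership in it must survive the limit
  taken in \<open>nested_balls_limit\<close>.\<close>

lemma law_continuous:
  fixes K :: "'a::euclidean_space set"
  assumes "compact K" "openin (weak_topology K) V" "X \<in> rvs K" "law X \<in> V"
  shows "\<exists>d>0. \<forall>Y\<in>rvs K. L1_dist X Y \<le> d \<longrightarrow> law Y \<in> V"
proof -
  obtain F e where F: "finite F" "e > 0" "F \<subseteq> test_functions" "weak_nbhd K (law X) F e \<subseteq> V"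
    using openin_weak_topologyD[OF assms(2,4)] by blast
  define P where "P f d \<longleftrightarrow> d > 0 \<and> (\<forall>Y\<in>rvs K. L1_dist X Y \<le> d \<longrightarrow>
      \<bar>(\<integral>x. f x \<partial>law Y) - (\<integral>x. f x \<partial>law X)\<bar> < e)" for f :: "'a \<Rightarrow> real" and d
  have "\<forall>f\<in>F. \<exists>d. P f d"
  proof
    fix f assume "f \<in> F"
    then have "continuous_on UNIV f" "bounded (range f)" using F(3) by (auto simp: test_functions_def)
    then show "\<exists>d. P f d"
      using law_continuous_function[OF assms(1) _ _ assms(3) F(2)] by (simp add: P_def)
  qed
  from bchoice[OF this] obtain D where D: "\<forall>f\<in>F. P f (D f)" by (rule exE)
  \<comment> \<open>The 1 keeps the minimum meaningful and positive when \<open>F\<close> is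
    empty.\<close>
  define d where "d = Min (insert 1 (D ` F))"
  have "d > 0" using D F(1) by (auto simp: d_def P_def)
  moreover have "law Y \<in> V" if Y: "Y \<in> rvs K" "L1_dist X Y \<le> d" for Y
  proof -
    have "\<bar>(\<integral>x. f x \<partial>law Y) - (\<integral>x. f x \<partial>law X)\<bar> < e" if "f \<in> F" for f
    proof -
      have "d \<le> D f" using F(1) that by (simp add: d_def)
      then show ?thesis using D that Y by (simp add: P_def)
    qed
    moreover have "law Y \<in> prob_measures_on K"
      using Y(1) assms(1) by (intro law_in_prob_measures_on compact_imp_closed)
    ultimately show ?thesis using F(4) by (auto simp: weak_nbhd_def)
  qed
  ultimately show ?thesis by (intro exI[of _ d]) simp
qed

subsection \<open>Density of laws of step maps\<close>

lemma test_function_bounded: "f \<in> test_functions \<Longrightarrow> \<exists>b. \<forall>x. \<bar>f x\<bar> \<le> b"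
  by (auto simp: test_functions_def bounded_iff)

text \<open>Second moment method: the empirical average of \<open>M\<close> independent samples of \<open>\<mu>\<close> has variance
  of order \<open>1 / M\<close>, so some sample is good for all of \<open>F\<close> at once.\<close>

lemma law_of_large_numbers_sample:
  fixes \<mu> :: "'a::euclidean_space measure"
  assumes "closed K" and \<mu>: "\<mu> \<in> prob_measures_on K" and F: "finite F" "F \<subseteq> test_functions" and e: "e > 0"
  shows "\<exists>M>0. \<exists>h. range h \<subseteq> K \<and> (\<forall>f\<in>F. \<bar>(\<Sum>k<M. f (h k)) / real M - (\<integral>x. f x \<partial>\<mu>)\<bar> < e)"
proof -
  interpret \<mu>: prob_space \<mu> using prob_measures_onD[OF \<mu>] by simp
  note [simp, measurable_cong] = prob_measures_onD(2)[OF \<mu>]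
  note [simp] = prob_measures_onD(3)[OF \<mu>]
  have meas_F[measurable]: "f \<in> borel_measurable borel" if "f \<in> F" for f
    using that F by (auto simp: test_functions_def borel_measurable_continuous_onI)
  define g where "g f x = f x - (\<integral>x. f x \<partial>\<mu>)" for f :: "'a \<Rightarrow> real" and x
  have gm[measurable]: "g f \<in> borel_measurable borel" if "f \<in> F" for f
    unfolding g_def[abs_def] using meas_F[OF that] by simp
  have "\<exists>c. \<forall>x. \<bar>g f x\<bar> \<le> c" if fF: "f \<in> F" for f
  proof -
    obtain b where "\<And>x. \<bar>f x\<bar> \<le> b"
      using test_function_bounded[of f] fF F(2) by blast
    then have "\<bar>g f x\<bar> \<le> b + \<bar>\<integral>x. f x \<partial>\<mu>\<bar>" for x
      unfolding g_def by (intro order_trans[OF abs_triangle_ineq4]) simp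
    then show ?thesis by blast
  qed
  then obtain c where c: "\<And>f x. f \<in> F \<Longrightarrow> \<bar>g f x\<bar> \<le> c f" by metis
  have g0: "(\<integral>x. g f x \<partial>\<mu>) = 0" if fF: "f \<in> F" for f
  proof -
    obtain b where "\<And>x. \<bar>f x\<bar> \<le> b"
      using test_function_bounded[of f] fF F(2) by blast
    then have "integrable \<mu> f"
      using that by (intro \<mu>.integrable_const_bound[of _ b]) auto
    then show ?thesis unfolding g_def using \<mu>.prob_space by simp
  qed
  have gi: "integrable \<mu> (g f)" if "f \<in> F" for f
    using that c by (intro \<mu>.integrable_const_bound[of _ "c f"]) auto
  define S where "S = (\<Sum>f\<in>F. (c f)\<^sup>2)"
  \<comment> \<open>\<open>S\<close> adds up the squared bounds of all test functions. The choice
    gives \<open>S < M * e\<^sup>2\<close>, so the expected value of \<open>T\<close> below, at most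
    \<open>M * S\<close>, stays under the threshold \<open>(M * e)\<^sup>2\<close>.\<close>
  define M where "M = nat \<lceil>S / e\<^sup>2\<rceil> + 1"
  have "M > 0" by (simp add: M_def)
  have "S / e\<^sup>2 < real M" unfolding M_def by linarith
  then have MS: "S < real M * e\<^sup>2" using e by (simp add: field_simps)
  define P where "P = PiM {..<M} (\<lambda>_. \<mu>)"
  interpret P: product_prob_space "\<lambda>_::nat. \<mu>" "{..<M}"
    by unfold_locales
  have [simp]: "space P = {..<M} \<rightarrow>\<^sub>E UNIV" by (simp add: P_def space_PiM)
  interpret PP: prob_space P
    unfolding P_def by (rule P.prob_space_axioms)
  have comp[measurable]: "(\<lambda>x. x i) \<in> measurable P borel" if "i < M" for i
    using measurable_component_singleton[of i "{..<M}" "\<lambda>_. \<mu>"] that unfolding P_def by simp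
  have comp2[measurable]: "(\<lambda>x. g f (x i)) \<in> borel_measurable P" if "i < M" "f \<in> F" for i f
    using that by measurable
  have int2: "integrable P (\<lambda>x. g f (x i) * g f (x j))" if "i < M" "j < M" "f \<in> F" for i j f
  proof (rule PP.integrable_const_bound[of _ "c f * c f"])
    show "AE x in P. norm (g f (x i) * g f (x j)) \<le> c f * c f"
      using c[OF that(3)] by (auto simp: abs_mult intro!: mult_mono order_trans[OF abs_ge_zero c[OF that(3)]])
    show "(\<lambda>x. g f (x i) * g f (x j)) \<in> borel_measurable P" using that by simp
  qed
  have cov: "(\<integral>x. g f (x i) * g f (x j) \<partial>P) \<le> (if i = j then (c f)\<^sup>2 else 0)"
    if "i < M" "j < M" "f \<in> F" for i j f
  proof (cases "i = j")
    case True
    have "(\<integral>x. g f (x i) * g f (x j) \<partial>P) \<le> (\<integral>x. (c f)\<^sup>2 \<partial>P)"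
    proof (rule integral_mono)
      show "integrable P (\<lambda>x. g f (x i) * g f (x j))" by (rule int2) fact+
      show "g f (x i) * g f (x j) \<le> (c f)\<^sup>2" for x
        using c[OF that(3), of "x i"] True abs_le_square_iff[of "g f (x i)" "c f"]
        by (smt (verit) power2_eq_square)
    qed simp
    then show ?thesis using True by (simp add: PP.prob_space[simplified])
  next
    case False
    \<comment> \<open>The constant 1 fills the coordinates other than \<open>i\<close> and
      \<open>j\<close>, so that the product formula over all of \<open>{..<M}\<close> applies. The
      factor at \<open>i\<close> has integral 0, hence the covariance vanishes.\<close>
    define \<phi> where "\<phi> k = (if k = i \<or> k = j then g f else (\<lambda>_. 1))" for k
    have "g f (x i) * g f (x j) = (\<Prod>k<M. \<phi> k (x k))" for x
    proof -
      have "(\<Prod>k<M. \<phi> k (x k)) = (\<Prod>k\<in>{i,j}. \<phi> k (x k))"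
        using that by (intro prod.mono_neutral_right) (auto simp: \<phi>_def)
      then show ?thesis using False by (simp add: \<phi>_def)
    qed
    then have "(\<integral>x. g f (x i) * g f (x j) \<partial>P) = (\<integral>x. (\<Prod>k<M. \<phi> k (x k)) \<partial>P)"
      by simp
    also have "\<dots> = (\<Prod>k<M. integral\<^sup>L \<mu> (\<phi> k))"
      unfolding P_def by (rule P.product_integral_prod) (auto simp: \<phi>_def gi that)
    also have "\<dots> = 0"
      using that g0[OF that(3)] by (intro prod_zero) (auto simp: \<phi>_def intro!: bexI[of _ i])
    finally show ?thesis by simp
  qed
  \<comment> \<open>The squared deviations are summed over \<open>F\<close>, so one sample with
    small \<open>T\<close> is good for every test function.\<close>
  define T where "T x = (\<Sum>f\<in>F. (\<Sum>i<M. g f (x i))\<^sup>2)" for x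
  have T_eq: "T x = (\<Sum>f\<in>F. \<Sum>i<M. \<Sum>j<M. g f (x i) * g f (x j))" for x
    by (simp add: T_def power2_eq_square sum_product)
  have T_int: "integrable P T"
    unfolding T_eq[abs_def] by (intro Bochner_Integration.integrable_sum int2) auto
  have "(\<integral>x. T x \<partial>P) = (\<Sum>f\<in>F. \<Sum>i<M. \<Sum>j<M. (\<integral>x. g f (x i) * g f (x j) \<partial>P))"
  proof -
    have "(\<integral>x. T x \<partial>P) = (\<Sum>f\<in>F. (\<integral>x. (\<Sum>i<M. \<Sum>j<M. g f (x i) * g f (x j)) \<partial>P))"
      unfolding T_eq
      by (rule Bochner_Integration.integral_sum) (intro Bochner_Integration.integrable_sum int2; simp)
    also have "\<dots> = (\<Sum>f\<in>F. \<Sum>i<M. (\<integral>x. (\<Sum>j<M. g f (x i) * g f (x j)) \<partial>P))"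
      by (intro sum.cong refl Bochner_Integration.integral_sum Bochner_Integration.integrable_sum int2; simp)
    also have "\<dots> = (\<Sum>f\<in>F. \<Sum>i<M. \<Sum>j<M. (\<integral>x. g f (x i) * g f (x j) \<partial>P))"
      by (intro sum.cong refl Bochner_Integration.integral_sum int2; simp)
    finally show ?thesis .
  qed
  also have "\<dots> \<le> (\<Sum>f\<in>F. \<Sum>i<M. \<Sum>j<M. (if i = j then (c f)\<^sup>2 else 0))"
    by (intro sum_mono cov) auto
  also have "\<dots> = real M * S"
    by (simp add: S_def sum_distrib_left)
  also have "\<dots> < (real M * e)\<^sup>2"
    using mult_strict_left_mono[OF MS, of "real M"] \<open>M > 0\<close> by (simp add: power2_eq_square mult_ac)
  finally have lt: "(\<integral>x. T x \<partial>P) < (real M * e)\<^sup>2" .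
  have AEK: "AE x in P. \<forall>i\<in>{..<M}. x i \<in> K"
  proof (rule AE_finite_allI)
    fix i assume i: "i \<in> {..<M}"
    have "AE y in \<mu>. y \<in> K"
      using prob_measures_onD(4)[OF \<mu>] assms(1) by (intro \<mu>.AE_prob_1) (auto simp: \<mu>.emeasure_eq_measure)
    then show "AE x in P. x i \<in> K"
      unfolding P_def using i by (intro AE_PiM_component) (auto intro: \<mu>.prob_space_axioms)
  qed simp
  \<comment> \<open>If almost every sample reached the threshold, so would the mean of
    \<open>T\<close>. The samples below it thus form a set that is not null, and some of them have
    all coordinates in \<open>K\<close>, which holds almost everywhere.\<close>
  have "\<not> (AE x in P. (real M * e)\<^sup>2 \<le> T x)"
  proof
    assume "AE x in P. (real M * e)\<^sup>2 \<le> T x"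
    then have "(\<integral>x. (real M * e)\<^sup>2 \<partial>P) \<le> (\<integral>x. T x \<partial>P)"
      by (intro integral_mono_AE T_int) auto
    with lt show False by (simp add: PP.prob_space[simplified])
  qed
  then have "\<exists>x. (\<forall>i\<in>{..<M}. x i \<in> K) \<and> T x < (real M * e)\<^sup>2"
  proof (rule contrapos_pp)
    assume "\<nexists>x. (\<forall>i\<in>{..<M}. x i \<in> K) \<and> T x < (real M * e)\<^sup>2"
    then have *: "\<forall>i\<in>{..<M}. x i \<in> K \<Longrightarrow> (real M * e)\<^sup>2 \<le> T x" for x
      by (meson not_le)
    show "\<not> \<not> (AE x in P. (real M * e)\<^sup>2 \<le> T x)"
      using eventually_mono[OF AEK *] by simp
  qed
  then obtain x where x: "\<And>i. i < M \<Longrightarrow> x i \<in> K" "T x < (real M * e)\<^sup>2" by auto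
  \<comment> \<open>Indices from \<open>M\<close> on get the value \<open>x 0\<close>, which lies in
    \<open>K\<close> because \<open>M > 0\<close>; \<open>range h \<subseteq> K\<close> concerns all
    natural numbers.\<close>
  define h where "h i = (if i < M then x i else x 0)" for i
  have "\<bar>(\<Sum>k<M. f (h k)) / real M - (\<integral>x. f x \<partial>\<mu>)\<bar> < e" if "f \<in> F" for f
  proof -
    have "(\<Sum>i<M. g f (x i))\<^sup>2 \<le> T x"
      unfolding T_def using that F(1) by (intro member_le_sum[of f F "\<lambda>f. (\<Sum>i<M. g f (x i))\<^sup>2"]) auto
    with x(2) have "(\<Sum>i<M. g f (x i))\<^sup>2 < (real M * e)\<^sup>2" by simp
    then have "\<bar>\<Sum>i<M. g f (x i)\<bar> < real M * e"
      using e power2_less_imp_less[of "\<bar>\<Sum>i<M. g f (x i)\<bar>" "real M * e"] by simp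
    moreover have "(\<Sum>i<M. g f (x i)) = real M * ((\<Sum>k<M. f (h k)) / real M - (\<integral>x. f x \<partial>\<mu>))"
      using \<open>M > 0\<close> by (simp add: g_def sum_subtractf h_def right_diff_distrib)
    ultimately have "real M * \<bar>(\<Sum>k<M. f (h k)) / real M - (\<integral>x. f x \<partial>\<mu>)\<bar> < real M * e"
      by (simp add: abs_mult)
    then show ?thesis using \<open>M > 0\<close> by simp
  qed
  moreover have "range h \<subseteq> K" using x(1) \<open>M > 0\<close> by (auto simp: h_def)
  ultimately show ?thesis using \<open>M > 0\<close> by blast
qed

lemma step_laws_dense:
  fixes K :: "'a::euclidean_space set"
  assumes "closed K" "openin (weak_topology K) V" "V \<noteq> {}"
  shows "\<exists>M h. M > 0 \<and> range h \<subseteq> K \<and> law (step M h) \<in> V"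
proof -
  obtain \<mu> where \<mu>: "\<mu> \<in> V" using assms(3) by auto
  then have \<mu>K: "\<mu> \<in> prob_measures_on K" using openin_subset[OF assms(2)] by auto
  obtain F e where F: "finite F" "e > 0" "F \<subseteq> test_functions" "weak_nbhd K \<mu> F e \<subseteq> V"
    using openin_weak_topologyD[OF assms(2) \<mu>] by blast
  obtain M h where h: "M > 0" "range h \<subseteq> K" "\<And>f. f \<in> F \<Longrightarrow> \<bar>(\<Sum>k<M. f (h k)) / real M - (\<integral>x. f x \<partial>\<mu>)\<bar> < e"
    using law_of_large_numbers_sample[OF assms(1) \<mu>K F(1,3,2)] by blast
  have "f \<in> borel_measurable borel" if "f \<in> F" for f
    using that F by (auto simp: test_functions_def borel_measurable_continuous_onI)
  then have "law (step M h) \<in> weak_nbhd K \<mu> F e"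
    using h assms(1) by (auto simp: weak_nbhd_def integral_law_step intro!: law_in_prob_measures_on step_in_rvs)
  then show ?thesis using h F by blast
qed

subsection \<open>A Baire theorem for the weak topology\<close>

text \<open>The \<open>M\<close> steps of \<open>h\<close> are cut into \<open>n\<close> pieces each: piece \<open>q\<close> lies in step \<open>q div n\<close>.\<close>

definition step_dense :: "'a::euclidean_space set \<Rightarrow> 'a measure set \<Rightarrow> bool" where
  "step_dense K U \<longleftrightarrow> (\<forall>M h e. M > 0 \<longrightarrow> range h \<subseteq> K \<longrightarrow> e > 0 \<longrightarrow>
     (\<exists>n h'. n > 0 \<and> range h' \<subseteq> K \<and> (\<Sum>q<M * n. norm (h (q div n) - h' q)) \<le> e * real (M * n) \<and>
        law (step (M * n) h') \<in> U))"

text \<open>The sum of the norms of the increments has finite integral, hence is finite almost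
  everywhere. Absolute convergence of the increments then gives convergence of the sequence by
  telescoping.\<close>

lemma AE_convergent_if_summable_L1_dist:
  fixes X :: "nat \<Rightarrow> real \<Rightarrow> 'a::euclidean_space"
  assumes "bounded K" "\<And>j. X j \<in> rvs K" "summable (\<lambda>j. L1_dist (X j) (X (Suc j)))"
  shows "AE \<omega> in unit_prob. convergent (\<lambda>j. X j \<omega>)"
proof -
  have [measurable]: "X j \<in> borel_measurable unit_prob" for j
    using assms(2)[of j] by (simp add: rvs_def)
  have L1: "(\<integral>\<^sup>+\<omega>. ennreal (norm (X j \<omega> - X (Suc j) \<omega>)) \<partial>unit_prob) = ennreal (L1_dist (X j) (X (Suc j)))" for j
    unfolding L1_dist_def
    using integrable_norm_diff_rvs[OF assms(1) assms(2) assms(2)] by (intro nn_integral_eq_integral) auto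
  have L1_nonneg: "0 \<le> L1_dist (X j) (X (Suc j))" for j
    by (simp add: L1_dist_def)
  have "(\<integral>\<^sup>+\<omega>. (\<Sum>j. ennreal (norm (X j \<omega> - X (Suc j) \<omega>))) \<partial>unit_prob) = (\<Sum>j. ennreal (L1_dist (X j) (X (Suc j))))"
    by (subst nn_integral_suminf) (auto simp: L1)
  also have "\<dots> = ennreal (\<Sum>j. L1_dist (X j) (X (Suc j)))"
    using assms(3) L1_nonneg by (simp add: suminf_ennreal2)
  finally have "(\<integral>\<^sup>+\<omega>. (\<Sum>j. ennreal (norm (X j \<omega> - X (Suc j) \<omega>))) \<partial>unit_prob) \<noteq> \<infinity>"
    by simp
  then have "AE \<omega> in unit_prob. (\<Sum>j. ennreal (norm (X j \<omega> - X (Suc j) \<omega>))) \<noteq> \<infinity>"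
    by (intro nn_integral_PInf_AE) auto
  then show ?thesis
  proof eventually_elim
    case (elim \<omega>)
    then have "summable (\<lambda>j. norm (X j \<omega> - X (Suc j) \<omega>))"
      by (intro summable_suminf_not_top) auto
    then have "summable (\<lambda>j. X (Suc j) \<omega> - X j \<omega>)"
      by (simp add: norm_minus_commute summable_norm_cancel)
    then have "convergent (\<lambda>n. \<Sum>j<n. X (Suc j) \<omega> - X j \<omega>)"
      by (simp add: summable_iff_convergent)
    then have "convergent (\<lambda>n. (\<Sum>j<n. X (Suc j) \<omega> - X j \<omega>) + X 0 \<omega>)"
      using convergent_add convergent_const by blast
    moreover have "(\<Sum>j<n. X (Suc j) \<omega> - X j \<omega>) + X 0 \<omega> = X n \<omega>" for n
      by (subst sum_lessThan_telescope) simp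
    ultimately show ?case by simp
  qed
qed

lemma L1_limit_exists:
  fixes X :: "nat \<Rightarrow> real \<Rightarrow> 'a::euclidean_space"
  assumes K: "compact K" and X: "\<And>j. X j \<in> rvs K" and s: "summable (\<lambda>j. L1_dist (X j) (X (Suc j)))"
  shows "\<exists>Y\<in>rvs K. \<forall>j. (\<lambda>i. L1_dist (X j) (X i)) \<longlonglongrightarrow> L1_dist (X j) Y"
proof -
  have bK: "bounded K" and cK: "closed K" using K by (auto intro: compact_imp_bounded compact_imp_closed)
  have [measurable]: "X j \<in> borel_measurable unit_prob" for j
    using X[of j] by (simp add: rvs_def)
  have XK: "X j \<omega> \<in> K" for j \<omega> using X[of j] by (auto simp: rvs_def)
  define Y0 where "Y0 \<omega> = lim (\<lambda>j. X j \<omega>)" for \<omega>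
  \<comment> \<open>On the null set without convergence \<open>lim\<close> is arbitrary. Replacing
    it there by \<open>X 0\<close> keeps every value in \<open>K\<close> and keeps the function
    measurable.\<close>
  define Y where "Y \<omega> = (if Y0 \<omega> \<in> K then Y0 \<omega> else X 0 \<omega>)" for \<omega>
  have Y0m[measurable]: "Y0 \<in> borel_measurable unit_prob"
    unfolding Y0_def[abs_def] by measurable
  have [measurable]: "K \<in> sets borel" using cK by simp
  have Ym[measurable]: "Y \<in> borel_measurable unit_prob"
    unfolding Y_def[abs_def] by measurable
  have Y: "Y \<in> rvs K" using XK Ym by (auto simp: rvs_def Y_def)
  have lim: "AE \<omega> in unit_prob. (\<lambda>j. X j \<omega>) \<longlonglongrightarrow> Y \<omega>"
    using AE_convergent_if_summable_L1_dist[OF bK X s]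
  proof eventually_elim
    case (elim \<omega>)
    then have "(\<lambda>j. X j \<omega>) \<longlonglongrightarrow> Y0 \<omega>" by (simp add: Y0_def convergent_LIMSEQ_iff)
    moreover from this have "Y0 \<omega> \<in> K" by (rule closed_sequentially[OF cK XK])
    ultimately show ?case by (simp add: Y_def)
  qed
  obtain B where B: "\<And>x. x \<in> K \<Longrightarrow> norm x \<le> B" using bK by (auto simp: bounded_iff)
  have "(\<lambda>i. L1_dist (X j) (X i)) \<longlonglongrightarrow> L1_dist (X j) Y" for j
    unfolding L1_dist_def
  proof (rule integral_dominated_convergence[where w = "\<lambda>_. B + B"])
    show "AE \<omega> in unit_prob. (\<lambda>i. norm (X j \<omega> - X i \<omega>)) \<longlonglongrightarrow> norm (X j \<omega> - Y \<omega>)"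
      using lim by eventually_elim (intro tendsto_intros)
    show "AE \<omega> in unit_prob. norm (norm (X j \<omega> - X i \<omega>)) \<le> B + B" for i
    proof (rule AE_I2)
      show "norm (norm (X j \<omega> - X i \<omega>)) \<le> B + B" for \<omega>
        using norm_triangle_ineq4[of "X j \<omega>" "X i \<omega>"] B[OF XK[of j \<omega>]] B[OF XK[of i \<omega>]] by simp
    qed
  qed auto
  with Y show ?thesis by blast
qed

lemma nested_balls_limit:
  fixes X :: "nat \<Rightarrow> real \<Rightarrow> 'a::euclidean_space"
  assumes K: "compact K" and X: "\<And>j. X j \<in> rvs K"
    and e: "\<And>j. e j > 0" "\<And>j. e (Suc j) \<le> e j / 2" "\<And>j. L1_dist (X j) (X (Suc j)) \<le> e j / 2"
  shows "\<exists>Y\<in>rvs K. \<forall>j. L1_dist (X j) Y \<le> e j"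
proof -
  have e0: "e j \<le> e 0 * (1 / 2) ^ j" for j
  proof (induction j)
    case (Suc j)
    then show ?case using e(2)[of j] by simp
  qed simp
  have "summable (\<lambda>j. L1_dist (X j) (X (Suc j)))"
  proof (rule summable_comparison_test')
    show "summable (\<lambda>j. e 0 * (1 / 2) ^ j)" by (intro summable_mult summable_geometric) simp
    show "norm (L1_dist (X j) (X (Suc j))) \<le> e 0 * (1 / 2) ^ j" for j
      using e(3)[of j] e0[of j] e(1)[of j] by (simp add: L1_dist_def)
  qed
  then obtain Y where Y: "Y \<in> rvs K" "\<And>j. (\<lambda>i. L1_dist (X j) (X i)) \<longlonglongrightarrow> L1_dist (X j) Y"
    using L1_limit_exists[of K X, OF K X] by blast
  \<comment> \<open>By the triangle inequality this says that the ball of radius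
    \<open>e (j + k)\<close> around \<open>X (j + k)\<close> lies inside the one of radius
    \<open>e j\<close> around \<open>X j\<close>. The induction works because each move and each new
    radius use at most half of the old radius.\<close>
  have step: "L1_dist (X j) (X (j + k)) + e (j + k) \<le> e j" for j k
  proof (induction k)
    case 0
    then show ?case by (simp add: L1_dist_def)
  next
    case (Suc k)
    have "L1_dist (X j) (X (j + Suc k)) \<le> L1_dist (X j) (X (j + k)) + L1_dist (X (j + k)) (X (j + Suc k))"
      by (rule L1_dist_triangle[OF compact_imp_bounded[OF K] X X X])
    with Suc e(2,3)[of "j + k"] show ?case by simp
  qed
  have "L1_dist (X j) Y \<le> e j" for j
  proof (rule LIMSEQ_le_const2[OF Y(2)], intro exI[of _ j] allI impI)
    fix i assume "j \<le> i"
    then obtain k where "i = j + k" by (auto simp: le_iff_add)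
    then show "L1_dist (X j) (X i) \<le> e j" using step[of j k] e(1)[of i] by simp
  qed
  with Y(1) show ?thesis by blast
qed

text \<open>\<open>step_dense\<close> can only be applied at step maps, so all centres of the nested
  balls are step maps. Only the limit is a general random variable, and its law lies in every open
  set because each closed ball was chosen with all its laws inside the corresponding set.\<close>

lemma weak_topology_step_Baire:
  fixes K :: "'a::euclidean_space set" and U :: "nat \<Rightarrow> 'a measure set"
  assumes K: "compact K" and U: "\<And>n. openin (weak_topology K) (U n)" "\<And>n. step_dense K (U n)"
  shows "weak_topology K closure_of (\<Inter>n. U n) = topspace (weak_topology K)"
  unfolding dense_intersects_open
proof (intro allI impI, elim conjE)
  fix V assume V: "openin (weak_topology K) V" "V \<noteq> {}"
  have cK: "closed K" using K by (rule compact_imp_closed)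
  \<comment> \<open>Placing the given open set at index 0 and shifting the others lets one sequence
    of balls treat them uniformly.\<close>
  define W where "W n = (case n of 0 \<Rightarrow> V | Suc m \<Rightarrow> U m)" for n
  have W: "openin (weak_topology K) (W n)" for n
    using U V by (simp add: W_def split: nat.split)
  define good where "good n s \<longleftrightarrow> (case s of (M, h, e) \<Rightarrow> M > (0::nat) \<and> range h \<subseteq> K \<and> e > (0::real) \<and>
      (\<forall>Y\<in>rvs K. L1_dist (step M h) Y \<le> e \<longrightarrow> law Y \<in> W n))" for n s
  define nxt where "nxt s t \<longleftrightarrow> (case s of (M, h, e) \<Rightarrow> case t of (M', h', e') \<Rightarrow>
      e' \<le> e / 2 \<and> L1_dist (step M h) (step M' h') \<le> e / 2)" for s t :: "nat \<times> (nat \<Rightarrow> 'a) \<times> real"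
  have "\<exists>S. \<forall>n. good n (S n) \<and> nxt (S n) (S (Suc n))"
  proof (rule dependent_nat_choice)
    obtain M h where h: "M > 0" "range h \<subseteq> K" "law (step M h) \<in> V"
      using step_laws_dense[OF cK V] by blast
    obtain d where "d > 0" "\<forall>Y\<in>rvs K. L1_dist (step M h) Y \<le> d \<longrightarrow> law Y \<in> V"
      using law_continuous[OF K V(1) step_in_rvs[OF h(2)] h(3)] by blast
    with h show "\<exists>s. good 0 s"
      by (intro exI[of _ "(M, h, d)"]) (simp add: good_def W_def)
  next
    fix s n assume "good n s"
    then obtain M h e where s: "s = (M, h, e)" "M > 0" "range h \<subseteq> K" "e > 0"
      by (cases s) (auto simp: good_def)
    then obtain k h' where h': "k > 0" "range h' \<subseteq> K" "(\<Sum>q<M * k. norm (h (q div k) - h' q)) \<le> e / 2 * real (M * k)"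
      "law (step (M * k) h') \<in> U n"
      using U(2)[of n, unfolded step_dense_def, rule_format, OF s(2,3) half_gt_zero[OF s(4)]]
      by (elim exE conjE) (rule that)
    obtain d where d: "d > 0" "\<forall>Y\<in>rvs K. L1_dist (step (M * k) h') Y \<le> d \<longrightarrow> law Y \<in> U n"
      using law_continuous[OF K U(1) step_in_rvs[OF h'(2)] h'(4)] by blast
    \<comment> \<open>The bound \<open>d\<close> keeps the laws of the new ball inside
      \<open>U n\<close>; the bound \<open>e / 2\<close> makes the radii halve, as
      \<open>nested_balls_limit\<close> demands.\<close>
    have "good (Suc n) (M * k, h', min d (e / 2))"
      using s h' d by (simp add: good_def W_def)
    moreover have "L1_dist (step M h) (step (M * k) h') \<le> e / 2"
      using h'(1,3) s(2) by (subst L1_dist_step_refine) (simp_all add: field_simps)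
    then have "nxt s (M * k, h', min d (e / 2))"
      by (simp add: nxt_def s(1))
    ultimately show "\<exists>t. good (Suc n) t \<and> nxt s t" by blast
  qed
  then obtain S where S: "\<And>n. good n (S n)" "\<And>n. nxt (S n) (S (Suc n))" by blast
  define X where "X n = (case S n of (M, h, e) \<Rightarrow> step M h)" for n
  define e where "e n = (case S n of (M, h, e) \<Rightarrow> e)" for n
  have good: "X n \<in> rvs K" "e n > 0" "\<And>Y. Y \<in> rvs K \<Longrightarrow> L1_dist (X n) Y \<le> e n \<Longrightarrow> law Y \<in> W n" for n
    using S(1)[of n] by (auto simp: X_def e_def good_def step_in_rvs split: prod.splits)
  have nxt: "e (Suc n) \<le> e n / 2" "L1_dist (X n) (X (Suc n)) \<le> e n / 2" for n
    using S(2)[of n] by (auto simp: X_def e_def nxt_def split: prod.splits)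
  obtain Y where Y: "Y \<in> rvs K" "\<And>n. L1_dist (X n) Y \<le> e n"
    using nested_balls_limit[of K X e, OF K good(1,2) nxt] by blast
  have YW: "law Y \<in> W n" for n using good(3)[OF Y(1) Y(2)] .
  have "law Y \<in> V" using YW[of 0] by (simp add: W_def)
  moreover have "law Y \<in> U n" for n using YW[of "Suc n"] by (simp add: W_def)
  ultimately show "(\<Inter>n. U n) \<inter> V \<noteq> {}" by blast
qed

lemma typicalI:
  fixes K :: "'a::euclidean_space set"
  assumes K: "compact K" and "countable \<U>" "\<U> \<noteq> {}"
    and U: "\<And>U. U \<in> \<U> \<Longrightarrow> openin (weak_topology K) U" "\<And>U. U \<in> \<U> \<Longrightarrow> step_dense K U"
    and P: "\<And>\<mu>. \<mu> \<in> \<Inter>\<U> \<Longrightarrow> P \<mu>"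
  shows "typical (weak_topology K) P"
  unfolding typical_def
proof (intro exI[of _ "\<Inter>\<U>"] conjI)
  show "gdelta_in (weak_topology K) (\<Inter>\<U>)"
    using assms by (intro gdelta_in_Inter) (auto intro: open_imp_gdelta_in)
  obtain F :: "nat \<Rightarrow> _" where F: "\<U> = range F"
    using range_from_nat_into[OF assms(3,2)] by metis
  then show "weak_topology K closure_of (\<Inter>\<U>) = topspace (weak_topology K)"
    using weak_topology_step_Baire[OF K, of F] U by auto
qed (use P in blast)

subsection \<open>Open conditions on small and large balls\<close>

definition net :: "'a::euclidean_space set \<Rightarrow> real \<Rightarrow> 'a set \<Rightarrow> bool" where
  "net K r C \<longleftrightarrow> finite C \<and> C \<subseteq> K \<and> K \<subseteq> (\<Union>c\<in>C. ball c r)"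

text \<open>Strict lower bounds are imposed on open balls and, in \<open>cball_lt\<close>, strict
  upper bounds on closed balls: these are the two kinds of ball conditions that are open in the weak
  topology.\<close>

definition ball_gt :: "'a::euclidean_space set \<Rightarrow> 'a set \<Rightarrow> real \<Rightarrow> real \<Rightarrow> 'a measure set" where
  "ball_gt K C r t = {\<mu> \<in> prob_measures_on K. \<forall>c\<in>C. t < measure \<mu> (ball c r)}"

definition cball_lt :: "'a::euclidean_space set \<Rightarrow> 'a set \<Rightarrow> real \<Rightarrow> real \<Rightarrow> 'a measure set" where
  "cball_lt K C r t = {\<mu> \<in> prob_measures_on K. \<forall>c\<in>C. measure \<mu> (cball c r) < t}"

text \<open>Positive mass around each point of one finite net. Membership for all \<open>m\<close>
  means that the support is all of \<open>K\<close>.\<close>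

definition full_supp :: "'a::euclidean_space set \<Rightarrow> nat \<Rightarrow> 'a measure set" where
  "full_supp K m = (\<Union>C\<in>{C. net K (1 / Suc m) C}. ball_gt K C (1 / Suc m) 0)"

text \<open>Such a ball makes the quotient in \<open>lower_Dplus\<close> smaller than 1/(m+1) at a
  radius below 1/(m+1). In the next definition the exponent \<open>m\<close> makes the quotient of
  \<open>upper_Dminus\<close> large instead.\<close>

definition big_ball :: "'a::euclidean_space set \<Rightarrow> nat \<Rightarrow> 'a measure set" where
  "big_ball K m = (\<Union>(y, r)\<in>K \<times> {0<..<1 / Suc m}. ball_gt K {y} r (r powr (1 / Suc m)))"

definition small_ball :: "'a::euclidean_space set \<Rightarrow> nat \<Rightarrow> 'a measure set" where
  "small_ball K m = (\<Union>(y, r)\<in>K \<times> {0<..<1 / Suc m}. cball_lt K {y} r (r powr m))"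

text \<open>Every ball of radius \<open>r\<close> centred in \<open>K\<close> lies in one of the
  closed balls of radius \<open>2 * r\<close>, so this bounds the supremum at radius
  \<open>r\<close> by \<open>r powr s\<close>.\<close>

definition spread :: "'a::euclidean_space set \<Rightarrow> nat \<Rightarrow> real \<Rightarrow> 'a measure set" where
  "spread K m s = (\<Union>(C, r)\<in>{(C, r). 0 < r \<and> r < 1 / Suc m \<and> net K r C}. cball_lt K C (2 * r) (r powr s))"

text \<open>Every ball of radius \<open>2 * r\<close> centred in \<open>K\<close> contains one of
  the net balls of radius \<open>r\<close>. The bound \<open>(2 * r) powr s\<close> is thus the one
  wanted for the infimum at radius \<open>2 * r\<close>.\<close>

definition evenly :: "'a::euclidean_space set \<Rightarrow> nat \<Rightarrow> real \<Rightarrow> 'a measure set" where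
  "evenly K m s = (\<Union>(C, r)\<in>{(C, r). 0 < r \<and> r < 1 / Suc m \<and> net K r C}. ball_gt K C r ((2 * r) powr s))"

lemma openin_ball_gt: "finite C \<Longrightarrow> openin (weak_topology K) (ball_gt K C r t)"
proof (induction C rule: finite_induct)
  case empty
  have "ball_gt K {} r t = topspace (weak_topology K)" by (simp add: ball_gt_def)
  then show ?case by (simp only: openin_topspace)
next
  case (insert c C)
  have "ball_gt K (insert c C) r t = {\<mu> \<in> prob_measures_on K. t < measure \<mu> (ball c r)} \<inter> ball_gt K C r t"
    by (auto simp: ball_gt_def)
  then show ?case
    using insert openin_weak_topology_measure_gt[of "ball c r" K t] by auto
qed

lemma openin_cball_lt: "finite C \<Longrightarrow> openin (weak_topology K) (cball_lt K C r t)"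
proof (induction C rule: finite_induct)
  case empty
  have "cball_lt K {} r t = topspace (weak_topology K)" by (simp add: cball_lt_def)
  then show ?case by (simp only: openin_topspace)
next
  case (insert c C)
  have "cball_lt K (insert c C) r t = {\<mu> \<in> prob_measures_on K. measure \<mu> (cball c r) < t} \<inter> cball_lt K C r t"
    by (auto simp: cball_lt_def)
  then show ?case
    using insert openin_weak_topology_measure_lt[of "cball c r" K t] by auto
qed

lemma openin_full_supp: "openin (weak_topology K) (full_supp K m)"
  unfolding full_supp_def by (rule openin_Union) (auto simp: net_def intro: openin_ball_gt)

lemma openin_big_ball: "openin (weak_topology K) (big_ball K m)"
  unfolding big_ball_def by (rule openin_Union) (auto intro: openin_ball_gt)

lemma openin_small_ball: "openin (weak_topology K) (small_ball K m)"
  unfolding small_ball_def by (rule openin_Union) (auto intro: openin_cball_lt)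

lemma openin_spread: "openin (weak_topology K) (spread K m s)"
  unfolding spread_def by (rule openin_Union) (auto simp: net_def intro: openin_cball_lt)

lemma openin_evenly: "openin (weak_topology K) (evenly K m s)"
  unfolding evenly_def by (rule openin_Union) (auto simp: net_def intro: openin_ball_gt)

section \<open>Finite nets, powers of the radius, logarithmic quotients\<close>

lemma compact_imp_net:
  assumes "compact K" "r > 0"
  shows "\<exists>C. net K r C"
proof -
  have "K \<subseteq> (\<Union>c\<in>K. ball c r)" using assms(2) by auto
  then obtain C where "C \<subseteq> K" "finite C" "K \<subseteq> (\<Union>c\<in>C. ball c r)"
    using compactE_image[OF assms(1), of K "\<lambda>c. ball c r"] by auto
  then show ?thesis by (auto simp: net_def)
qed

text \<open>This absorbs constants: number of atoms, mass of a fixed ball, and rescaling of the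
  radius all vanish in the gap between two exponents.\<close>

lemma eventually_powr_less:
  fixes a b s t :: real
  assumes "a > 0" "b > 0" "s < t"
  shows "eventually (\<lambda>r. a * r powr t < b * r powr s) (at_right 0)"
proof -
  have "((\<lambda>r. r powr (t - s)) \<longlongrightarrow> 0 powr (t - s)) (at_right (0::real))"
    using assms(3) eventually_mono[OF eventually_at_right_less[of "0::real"] less_imp_le]
    by (intro tendsto_powr2 tendsto_intros) auto
  then have "((\<lambda>r. r powr (t - s)) \<longlongrightarrow> 0) (at_right (0::real))" by simp
  then have "eventually (\<lambda>r. r powr (t - s) < b / a) (at_right 0)"
    using assms by (intro order_tendstoD(2)) auto
  moreover have "eventually (\<lambda>r::real. 0 < r) (at_right 0)" by (simp add: eventually_at_right_less)
  ultimately show ?thesis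
  proof eventually_elim
    case (elim r)
    have "r powr t = r powr (t - s) * r powr s" by (simp flip: powr_add)
    moreover have "r powr (t - s) * r powr s < b / a * r powr s"
      using elim by (intro mult_strict_right_mono) auto
    ultimately have "r powr t < b / a * r powr s" by simp
    then show ?case using assms by (simp add: field_simps)
  qed
qed

lemma eventually_at_right_lt: "0 < (c::real) \<Longrightarrow> eventually (\<lambda>r. 0 < r \<and> r < c) (at_right 0)"
  using eventually_at_right_less[of "0::real"] eventually_at_right_real[of 0 c] by (auto elim!: eventually_elim2)

text \<open>For a radius below 1 the logarithm is negative, so dividing by it reverses inequalities.
  With this, bounds on the dimension quotients become comparisons of masses with powers of the
  radius.\<close>

lemma ln_div_ln_iff:
  fixes r x s :: real
  assumes "0 < r" "r < 1" "0 < x"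
  shows "ln x / ln r \<le> s \<longleftrightarrow> r powr s \<le> x" "s \<le> ln x / ln r \<longleftrightarrow> x \<le> r powr s"
    "ln x / ln r < s \<longleftrightarrow> r powr s < x" "s < ln x / ln r \<longleftrightarrow> x < r powr s"
proof -
  have neg: "ln r < 0" using assms by simp
  have le: "ln x / ln r \<le> s \<longleftrightarrow> r powr s \<le> x" for s
  proof -
    have "ln x / ln r \<le> s \<longleftrightarrow> s * ln r \<le> ln x" using neg by (simp add: divide_le_eq)
    also have "s * ln r = ln (r powr s)" using assms by (simp add: ln_powr)
    also have "ln (r powr s) \<le> ln x \<longleftrightarrow> r powr s \<le> x" using assms by (intro ln_le_cancel_iff) auto
    finally show ?thesis .
  qed
  have ge: "s \<le> ln x / ln r \<longleftrightarrow> x \<le> r powr s" for s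
  proof -
    have "s \<le> ln x / ln r \<longleftrightarrow> ln x \<le> s * ln r" using neg by (simp add: le_divide_eq)
    also have "s * ln r = ln (r powr s)" using assms by (simp add: ln_powr)
    also have "ln x \<le> ln (r powr s) \<longleftrightarrow> x \<le> r powr s" using assms by (intro ln_le_cancel_iff) auto
    finally show ?thesis .
  qed
  show "ln x / ln r \<le> s \<longleftrightarrow> r powr s \<le> x" "s \<le> ln x / ln r \<longleftrightarrow> x \<le> r powr s" by (fact le ge)+
  show "ln x / ln r < s \<longleftrightarrow> r powr s < x" "s < ln x / ln r \<longleftrightarrow> x < r powr s"
    using le[of s] ge[of s] by linarith+
qed

lemma ln_div_minus_ln_iff:
  fixes r x s :: real
  assumes "0 < r" "r < 1" "0 < x"
  shows "ln x / - ln r < s \<longleftrightarrow> x < r powr (- s)" "s < ln x / - ln r \<longleftrightarrow> r powr (- s) < x"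
  using ln_div_ln_iff(3,4)[OF assms, of "- s"] by (auto simp: minus_less_iff less_minus_iff)

section \<open>Cutting and moving the steps of a step map\<close>

lemma sum_div_mod:
  fixes f :: "nat \<Rightarrow> nat \<Rightarrow> 'b::comm_monoid_add"
  assumes "n > 0"
  shows "(\<Sum>q<M * n. f (q div n) (q mod n)) = (\<Sum>i<M. \<Sum>j<n. f i j)"
proof -
  have "(\<Sum>q<M * n. f (q div n) (q mod n)) = (\<Sum>i<M. \<Sum>q\<in>{i * n..<i * n + n}. f (q div n) (q mod n))"
    by (simp add: sum.nat_group)
  also have "\<dots> = (\<Sum>i<M. \<Sum>j<n. f i j)"
  proof (rule sum.cong[OF refl])
    fix i
    have "(\<Sum>q\<in>{i * n..<i * n + n}. f (q div n) (q mod n)) = (\<Sum>j\<in>{0..<n}. f ((j + i * n) div n) ((j + i * n) mod n))"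
      using sum.shift_bounds_nat_ivl[of "\<lambda>q. f (q div n) (q mod n)" 0 "i * n" n] by (simp add: add.commute)
    also have "\<dots> = (\<Sum>j<n. f i j)"
      unfolding atLeast0LessThan using assms by (intro sum.cong) auto
    finally show "(\<Sum>q\<in>{i * n..<i * n + n}. f (q div n) (q mod n)) = (\<Sum>j<n. f i j)" .
  qed
  finally show ?thesis .
qed

text \<open>Two-index form of a refined step map: \<open>H i j\<close> is the new position of piece
  \<open>j\<close> of step \<open>i\<close>, which has flat index \<open>i * n + j\<close>.\<close>

definition split_law :: "nat \<Rightarrow> nat \<Rightarrow> (nat \<Rightarrow> nat \<Rightarrow> 'a::euclidean_space) \<Rightarrow> 'a measure" where
  "split_law M n H = law (step (M * n) (\<lambda>q. H (q div n) (q mod n)))"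

lemma measure_split_law:
  assumes "M > 0" "n > 0" "A \<in> sets borel"
  shows "measure (split_law M n H) A = (\<Sum>i<M. \<Sum>j<n. indicator A (H i j)) / real (M * n)"
proof -
  have "measure (split_law M n H) A = (\<integral>x. indicator A x \<partial>split_law M n H)"
    by (simp add: split_law_def)
  also have "\<dots> = (\<Sum>q<M * n. indicator A (H (q div n) (q mod n))) / real (M * n)"
    unfolding split_law_def using assms by (subst integral_law_step) auto
  finally show ?thesis
    using sum_div_mod[OF assms(2), of "\<lambda>i j. indicator A (H i j) :: real" M] by simp
qed

text \<open>The double sum is \<open>M * n\<close> times the L1 distance. It is a budget for the
  total displacement, so individual pieces may move far.\<close>

definition close_split ::
  "'a::euclidean_space set \<Rightarrow> real \<Rightarrow> nat \<Rightarrow> (nat \<Rightarrow> 'a) \<Rightarrow> nat \<Rightarrow> (nat \<Rightarrow> nat \<Rightarrow> 'a) \<Rightarrow> bool" where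
  "close_split K e M h n H \<longleftrightarrow> n > 0 \<and> (\<forall>i j. H i j \<in> K) \<and>
     (\<Sum>i<M. \<Sum>j<n. norm (h i - H i j)) \<le> e * real (M * n)"

lemma step_denseI:
  assumes "\<And>M h e. M > 0 \<Longrightarrow> range h \<subseteq> K \<Longrightarrow> e > 0 \<Longrightarrow>
    \<exists>n H. close_split K e M h n H \<and> split_law M n H \<in> U"
  shows "step_dense K U"
  unfolding step_dense_def
proof (intro allI impI)
  fix M :: nat and h :: "nat \<Rightarrow> 'a" and e :: real
  assume "M > 0" "range h \<subseteq> K" "e > 0"
  from assms[OF this] obtain n H where H: "n > 0" "\<And>i j. H i j \<in> K"
    "(\<Sum>i<M. \<Sum>j<n. norm (h i - H i j)) \<le> e * real (M * n)" "split_law M n H \<in> U"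
    by (auto simp: close_split_def)
  then show "\<exists>n h'. 0 < n \<and> range h' \<subseteq> K \<and> (\<Sum>q<M * n. norm (h (q div n) - h' q)) \<le> e * real (M * n) \<and> law (step (M * n) h') \<in> U"
    using sum_div_mod[OF H(1), of "\<lambda>i j. norm (h i - H i j)" M]
    by (intro exI[of _ n] exI[of _ "\<lambda>q. H (q div n) (q mod n)"]) (auto simp: split_law_def)
qed

lemma split_law_in_prob_measures_on:
  assumes "closed K" "\<And>i j. H i j \<in> K"
  shows "split_law M n H \<in> prob_measures_on K"
  unfolding split_law_def using assms by (intro law_in_prob_measures_on step_in_rvs) auto

lemma bounded_norm_diff:
  assumes "bounded K"
  obtains D where "D > 0" "\<And>x y. x \<in> K \<Longrightarrow> y \<in> K \<Longrightarrow> norm (x - y) \<le> D"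
proof -
  obtain B where B: "B > 0" "\<And>x. x \<in> K \<Longrightarrow> norm x \<le> B" using assms by (auto simp: bounded_pos)
  have "norm (x - y) \<le> 2 * B" if "x \<in> K" "y \<in> K" for x y
    using norm_triangle_ineq4[of x y] B(2)[OF that(1)] B(2)[OF that(2)] by simp
  then show ?thesis using B(1) that[of "2 * B"] by simp
qed

text \<open>The number \<open>t\<close> is at least the diameter of \<open>K\<close> divided by
  \<open>e\<close>: sending a share 1/t of the mass anywhere in \<open>K\<close> costs at most
  \<open>e\<close>.\<close>

lemma bounded_norm_diff_multiple:
  assumes "bounded K" "e > 0"
  shows "\<exists>t::nat. t > 0 \<and> (\<forall>x\<in>K. \<forall>y\<in>K. norm (x - y) \<le> e * real t)"
proof -
  obtain D where D: "\<And>x y. x \<in> K \<Longrightarrow> y \<in> K \<Longrightarrow> norm (x - y) \<le> D"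
    using bounded_norm_diff[OF assms(1)] by blast
  define t where "t = nat \<lceil>D / e\<rceil> + 1"
  have "D / e \<le> real t" unfolding t_def by linarith
  then have "D \<le> e * real t" using assms(2) by (simp add: field_simps)
  then have "\<forall>x\<in>K. \<forall>y\<in>K. norm (x - y) \<le> e * real t" using D by (meson order_trans)
  then show ?thesis by (intro exI[of _ t]) (simp add: t_def)
qed

text \<open>With \<open>p\<close> points in \<open>C\<close> every step is cut into
  \<open>p * t\<close> pieces, and one piece goes to each point. The moved share is 1/t, and each
  point receives mass at least 1/(p * t). This bound is free of \<open>M\<close>, and
  \<open>t\<close> is fixed before \<open>C\<close>, so in \<open>step_dense_evenly\<close> the net
  may be chosen at a radius depending on \<open>t\<close>.\<close>

lemma add_uniform_atoms:
  fixes K :: "'a::euclidean_space set"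
  assumes t: "t > 0" "\<forall>x\<in>K. \<forall>y\<in>K. norm (x - y) \<le> e * real t"
    and M: "M > 0" and h: "range h \<subseteq> K" and C: "finite C" "C \<noteq> {}" "C \<subseteq> K"
  shows "\<exists>n H. close_split K e M h n H \<and>
      (\<forall>c\<in>C. \<forall>A\<in>sets borel. c \<in> A \<longrightarrow> 1 / (real (card C) * real t) \<le> measure (split_law M n H) A)"
proof -
  define p where "p = card C"
  have p: "p > 0" using C by (simp add: p_def card_gt_0_iff)
  obtain g where g: "bij_betw g {..<p} C"
    using ex_bij_betw_nat_finite[OF C(1)] by (auto simp: p_def atLeast0LessThan)
  define n where "n = p * t"
  have n: "n > 0" "p \<le> n" using p t(1) by (auto simp: n_def)
  define H where "H i j = (if j < p then g j else h i)" for i j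
  have HK: "H i j \<in> K" for i j
    using g h C(3) by (auto simp: H_def bij_betw_def)
  have hK: "h i \<in> K" for i using h by auto
  have "(\<Sum>j<n. norm (h i - H i j)) \<le> e * real t * p" for i
  proof -
    have "(\<Sum>j<n. norm (h i - H i j)) = (\<Sum>j<p. norm (h i - H i j))"
      using n(2) by (intro sum.mono_neutral_right) (auto simp: H_def)
    also have "\<dots> \<le> (\<Sum>j<p. e * real t)" using t(2) hK HK by (intro sum_mono) blast
    finally show ?thesis by (simp add: mult.commute)
  qed
  then have "(\<Sum>i<M. \<Sum>j<n. norm (h i - H i j)) \<le> (\<Sum>i<M. e * real t * p)" by (intro sum_mono)
  also have "\<dots> = e * real (M * n)" by (simp add: n_def)
  finally have close: "(\<Sum>i<M. \<Sum>j<n. norm (h i - H i j)) \<le> e * real (M * n)" .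
  have mass: "1 / (real (card C) * real t) \<le> measure (split_law M n H) A"
    if c: "c \<in> C" "c \<in> A" "A \<in> sets borel" for c A
  proof -
    obtain k where k: "k < p" "g k = c" using g c(1) by (auto simp: bij_betw_def)
    have "1 \<le> (\<Sum>j<n. indicator A (H i j) :: real)" for i
      using member_le_sum[of k "{..<n}" "\<lambda>j. indicator A (H i j) :: real"] k n(2) c(2) by (simp add: H_def)
    then have "(\<Sum>i<M. 1) \<le> (\<Sum>i<M. \<Sum>j<n. indicator A (H i j) :: real)" by (intro sum_mono)
    then have "real M / real (M * n) \<le> measure (split_law M n H) A"
      unfolding measure_split_law[OF M n(1) c(3)] by (intro divide_right_mono) simp_all
    then show ?thesis using M by (simp add: n_def p_def)
  qed
  show ?thesis
  proof (intro exI conjI ballI impI)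
    show "close_split K e M h n H" using n(1) HK close by (simp add: close_split_def)
    show "1 / (real (card C) * real t) \<le> measure (split_law M n H) A"
      if "c \<in> C" "A \<in> sets borel" "c \<in> A" for c A
      using mass that by blast
  qed
qed

subsection \<open>Density by refining step maps\<close>

lemma net_nonempty: "net K r C \<Longrightarrow> K \<noteq> {} \<Longrightarrow> C \<noteq> {}"
  by (auto simp: net_def)

lemma step_dense_full_supp:
  fixes K :: "'a::euclidean_space set"
  assumes K: "compact K" "K \<noteq> {}"
  shows "step_dense K (full_supp K m)"
proof (rule step_denseI)
  fix M :: nat and h :: "nat \<Rightarrow> 'a" and e :: real
  assume M: "M > 0" "range h \<subseteq> K" "e > 0"
  obtain C where C: "net K (1 / Suc m) C" using compact_imp_net[OF K(1), of "1 / Suc m"] by auto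
  have C': "finite C" "C \<noteq> {}" "C \<subseteq> K" using C net_nonempty[OF C K(2)] by (simp_all add: net_def)
  obtain t :: nat where t: "t > 0" "\<forall>x\<in>K. \<forall>y\<in>K. norm (x - y) \<le> e * real t"
    using bounded_norm_diff_multiple[OF compact_imp_bounded[OF K(1)] M(3)] by blast
  obtain n H where H: "close_split K e M h n H"
    "\<forall>c\<in>C. \<forall>A\<in>sets borel. c \<in> A \<longrightarrow> 1 / (real (card C) * real t) \<le> measure (split_law M n H) A"
    using add_uniform_atoms[OF t M(1,2) C'] by blast
  have "0 < measure (split_law M n H) (ball c (1 / Suc m))" if "c \<in> C" for c
  proof -
    have "0 < 1 / (real (card C) * real t)" using t(1) C' by (simp add: card_gt_0_iff)
    also have "\<dots> \<le> measure (split_law M n H) (ball c (1 / Suc m))" using H(2) that by simp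
    finally show ?thesis .
  qed
  moreover have "split_law M n H \<in> prob_measures_on K"
    using H(1) K(1) by (intro split_law_in_prob_measures_on) (auto simp: close_split_def compact_imp_closed)
  ultimately have "split_law M n H \<in> full_supp K m"
    using C by (auto simp: full_supp_def ball_gt_def)
  with H(1) show "\<exists>n H. close_split K e M h n H \<and> split_law M n H \<in> full_supp K m"
    by blast
qed

lemma step_dense_big_ball:
  fixes K :: "'a::euclidean_space set"
  assumes K: "compact K"
  shows "step_dense K (big_ball K m)"
proof (rule step_denseI)
  fix M :: nat and h :: "nat \<Rightarrow> 'a" and e :: real
  assume M: "M > 0" "range h \<subseteq> K" "e > 0"
  define H where "H i j = h i" for i j :: nat
  have HK: "H i j \<in> K" for i j using M by (auto simp: H_def)
  \<comment> \<open>The exponent 0 encodes the constant 1/M, a lower bound for the mass of the atom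
    \<open>h 0\<close> at every radius.\<close>
  have "eventually (\<lambda>r::real. 1 * r powr (1 / Suc m) < 1 / M * r powr 0) (at_right 0)"
    using M(1) by (intro eventually_powr_less) auto
  moreover have "eventually (\<lambda>r::real. 0 < r \<and> r < 1 / Suc m) (at_right 0)"
    by (rule eventually_at_right_lt) simp
  ultimately have "eventually (\<lambda>r. 0 < r \<and> r < 1 / Suc m \<and> r powr (1 / Suc m) < 1 / M) (at_right 0)"
    by eventually_elim simp
  then obtain r where r: "0 < r" "r < 1 / Suc m" "r powr (1 / Suc m) < 1 / M"
    using eventually_happens[of _ "at_right (0::real)"] by auto
  have "1 \<le> (\<Sum>i<M. \<Sum>j<1. indicator (ball (h 0) r) (H i j) :: real)"
    using member_le_sum[of 0 "{..<M}" "\<lambda>i. \<Sum>j<1. indicator (ball (h 0) r) (H i j) :: real"] M(1) r(1)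
    by (simp add: H_def)
  then have "1 / M \<le> measure (split_law M 1 H) (ball (h 0) r)"
    using M(1) by (simp add: measure_split_law divide_right_mono)
  then have "r powr (1 / Suc m) < measure (split_law M 1 H) (ball (h 0) r)" using r(3) by linarith
  moreover have "split_law M 1 H \<in> prob_measures_on K"
    using HK K by (intro split_law_in_prob_measures_on compact_imp_closed)
  ultimately have "split_law M 1 H \<in> ball_gt K {h 0} r (r powr (1 / Suc m))" by (simp add: ball_gt_def)
  then have "split_law M 1 H \<in> big_ball K m"
    unfolding big_ball_def using r M(2) by (intro UN_I[of "(h 0, r)"]) auto
  moreover have "(\<Sum>i<M. \<Sum>j<1. norm (h i - H i j)) \<le> e * real (M * 1)" using M(3) by (simp add: H_def)
  ultimately show "\<exists>n H. close_split K e M h n H \<and> split_law M n H \<in> big_ball K m"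
    using HK by (intro exI[of _ 1] exI[of _ H]) (auto simp: close_split_def)
qed

text \<open>An infinite \<open>K\<close> has a point \<open>x\<close> away from the finitely many
  atoms. The radius is fixed first, small enough to keep the old atoms out of the ball around
  \<open>x\<close>; only then is \<open>n\<close> taken large, so that the single piece moved to
  \<open>x\<close> is as light as required.\<close>

lemma step_dense_small_ball:
  fixes K :: "'a::euclidean_space set"
  assumes K: "compact K" "infinite K"
  shows "step_dense K (small_ball K m)"
proof (rule step_denseI)
  fix M :: nat and h :: "nat \<Rightarrow> 'a" and e :: real
  assume M: "M > 0" "range h \<subseteq> K" "e > 0"
  obtain D where D: "D > 0" "\<And>x y. x \<in> K \<Longrightarrow> y \<in> K \<Longrightarrow> norm (x - y) \<le> D"
    using bounded_norm_diff[OF compact_imp_bounded[OF K(1)]] by blast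
  have "\<not> K \<subseteq> h ` {..<M}" using K(2) finite_subset by blast
  then obtain x where x: "x \<in> K" "x \<notin> h ` {..<M}" by blast
  obtain d where d: "d > 0" "\<And>y. y \<in> h ` {..<M} \<Longrightarrow> d \<le> dist x y"
    using finite_set_avoid[of "h ` {..<M}" x] x(2) by (metis finite_imageI finite_lessThan)
  obtain r where r: "0 < r" "r < min d (1 / Suc m)"
    using dense[of 0 "min d (1 / Suc m)"] d(1) by auto
  \<comment> \<open>The first entry of the maximum keeps the cost of moving one piece across
    \<open>K\<close> within budget; the second makes its mass, at most 1/n, smaller than
    \<open>r powr m\<close>.\<close>
  define n where "n = nat \<lceil>max (D / e) (1 / r powr m)\<rceil> + 1"
  have n: "n > 0" "D / e \<le> real n" "1 / r powr m < real n"
    unfolding n_def by (simp, linarith+)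
  define H where "H i j = (if i = 0 \<and> j = 0 then x else h i)" for i j :: nat
  have hK: "h i \<in> K" for i using M(2) by auto
  have HK: "H i j \<in> K" for i j using hK x(1) by (auto simp: H_def)
  have "(\<Sum>i<M. \<Sum>j<n. norm (h i - H i j)) = (\<Sum>i<M. if i = 0 then norm (h 0 - x) else 0)"
  proof (rule sum.cong[OF refl])
    fix i
    have "(\<Sum>j<n. norm (h i - H i j)) = (\<Sum>j<n. if j = 0 then (if i = 0 then norm (h 0 - x) else 0) else 0)"
      by (rule sum.cong) (auto simp: H_def)
    then show "(\<Sum>j<n. norm (h i - H i j)) = (if i = 0 then norm (h 0 - x) else 0)"
      using n(1) by simp
  qed
  also have "\<dots> \<le> D" using M(1) D(2)[OF hK x(1)] by simp
  also have "D \<le> e * real n" using n(2) M(3) by (simp add: field_simps)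
  also have "\<dots> \<le> e * real (M * n)" using M(1,3) by (intro mult_left_mono of_nat_mono) auto
  finally have close: "(\<Sum>i<M. \<Sum>j<n. norm (h i - H i j)) \<le> e * real (M * n)" .
  have "(\<Sum>i<M. \<Sum>j<n. indicator (cball x r) (H i j) :: real) = (\<Sum>i<M. if i = 0 then 1 else 0)"
  proof (rule sum.cong[OF refl])
    fix i assume "i \<in> {..<M}"
    then have "h i \<notin> cball x r" using d(2)[of "h i"] r(2) by auto
    then have "(\<Sum>j<n. indicator (cball x r) (H i j) :: real) = (\<Sum>j<n. if j = 0 then (if i = 0 then 1 else 0) else 0)"
      using r(1) by (intro sum.cong) (auto simp: H_def)
    then show "(\<Sum>j<n. indicator (cball x r) (H i j) :: real) = (if i = 0 then 1 else 0)"
      using n(1) by simp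
  qed
  then have "measure (split_law M n H) (cball x r) = 1 / real (M * n)"
    using M(1) n(1) by (simp add: measure_split_law)
  also have "\<dots> \<le> 1 / real n" using M(1) n(1) by (intro divide_left_mono) auto
  also have "\<dots> < r powr m" using n(1,3) r(1) by (simp add: field_simps)
  finally have "measure (split_law M n H) (cball x r) < r powr m" .
  moreover have "split_law M n H \<in> prob_measures_on K"
    using HK K(1) by (intro split_law_in_prob_measures_on compact_imp_closed)
  ultimately have "split_law M n H \<in> cball_lt K {x} r (r powr m)" by (simp add: cball_lt_def)
  then have "split_law M n H \<in> small_ball K m"
    unfolding small_ball_def using r x(1) by (intro UN_I[of "(x, r)"]) auto
  moreover have "close_split K e M h n H" using close n(1) HK by (simp add: close_split_def)
  ultimately show "\<exists>n H. close_split K e M h n H \<and> split_law M n H \<in> small_ball K m"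
    by blast
qed

section \<open>Covering numbers, separated points, frequently attained bounds\<close>

lemma covering_number_le:
  "finite C \<Longrightarrow> E \<subseteq> (\<Union>x\<in>C. ball x r) \<Longrightarrow> covering_number E r \<le> card C"
  unfolding covering_number_def by (rule Least_le) blast

lemma covering_number_witness:
  fixes K :: "'a::euclidean_space set"
  assumes "compact K" "E \<subseteq> K" "r > 0"
  shows "\<exists>C. finite C \<and> card C = covering_number E r \<and> E \<subseteq> (\<Union>x\<in>C. ball x r)"
proof -
  obtain C where "finite C" "K \<subseteq> (\<Union>x\<in>C. ball x r)"
    using compact_imp_net[OF assms(1,3)] by (auto simp: net_def)
  then have "\<exists>C'. finite C' \<and> card C' = card C \<and> E \<subseteq> (\<Union>x\<in>C'. ball x r)"
    using assms(2) by blast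
  then show ?thesis
    unfolding covering_number_def by (rule LeastI)
qed

lemma covering_number_pos:
  fixes K :: "'a::euclidean_space set"
  assumes "compact K" "E \<subseteq> K" "r > 0" "E \<noteq> {}"
  shows "covering_number E r > 0"
proof -
  obtain C where C: "finite C" "card C = covering_number E r" "E \<subseteq> (\<Union>x\<in>C. ball x r)"
    using covering_number_witness[OF assms(1-3)] by blast
  then have "C \<noteq> {}" using assms(4) by auto
  then show ?thesis using C by (metis card_gt_0_iff)
qed

text \<open>Greedy choice: fewer than \<open>covering_number A r\<close> balls of radius
  \<open>r\<close> cannot cover \<open>A\<close>, so some point of \<open>A\<close> has distance at
  least \<open>r\<close> from all points chosen so far.\<close>

lemma separated_points:
  fixes A :: "'a::metric_space set"
  assumes "n \<le> covering_number A r"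
  shows "\<exists>f. (\<forall>j<n. f j \<in> A) \<and> (\<forall>j<n. \<forall>k<n. j \<noteq> k \<longrightarrow> r \<le> dist (f j) (f k))"
  using assms
proof (induction n)
  case (Suc n)
  then obtain f where f: "\<forall>j<n. f j \<in> A" "\<forall>j<n. \<forall>k<n. j \<noteq> k \<longrightarrow> r \<le> dist (f j) (f k)" by auto
  have "\<not> A \<subseteq> (\<Union>x\<in>f ` {..<n}. ball x r)"
  proof
    assume "A \<subseteq> (\<Union>x\<in>f ` {..<n}. ball x r)"
    then have "covering_number A r \<le> card (f ` {..<n})" by (intro covering_number_le) auto
    also have "\<dots> \<le> n" using card_image_le[of "{..<n}" f] by simp
    finally show False using Suc.prems by simp
  qed
  then obtain x where "x \<in> A" "x \<notin> (\<Union>x\<in>f ` {..<n}. ball x r)" by blast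
  then have x: "x \<in> A" "\<And>j. j < n \<Longrightarrow> r \<le> dist (f j) x" by (simp_all add: not_less)
  show ?case
  proof (intro exI[of _ "f(n := x)"] conjI allI impI)
    show "(f(n := x)) j \<in> A" if "j < Suc n" for j
      using that f(1) x(1) by (auto simp: less_Suc_eq)
    show "r \<le> dist ((f(n := x)) j) ((f(n := x)) k)" if "j < Suc n" "k < Suc n" "j \<noteq> k" for j k
      using that f(2) x(2)[of j] x(2)[of k] by (auto simp: less_Suc_eq dist_commute)
  qed
qed simp

lemma frequently_gt_of_Limsup:
  fixes f :: "'b \<Rightarrow> ereal"
  assumes "c < Limsup F f"
  shows "frequently (\<lambda>x. c < f x) F"
proof (rule ccontr)
  assume "\<not> frequently (\<lambda>x. c < f x) F"
  then have "eventually (\<lambda>x. f x \<le> c) F" by (simp add: not_frequently not_less)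
  then have "Limsup F f \<le> c" by (rule Limsup_bounded)
  with assms show False by simp
qed

lemma frequently_lt_of_Liminf:
  fixes f :: "'b \<Rightarrow> ereal"
  assumes "Liminf F f < c"
  shows "frequently (\<lambda>x. f x < c) F"
proof (rule ccontr)
  assume "\<not> frequently (\<lambda>x. f x < c) F"
  then have "eventually (\<lambda>x. c \<le> f x) F" by (simp add: not_frequently not_less)
  then have "c \<le> Liminf F f" by (rule Liminf_bounded)
  with assms show False by simp
qed

text \<open>At arbitrarily small radii \<open>K\<close> has a cover by fewer than
  \<open>r powr - s'\<close> balls. Uniform mass on the centres gives each at least
  \<open>r powr s'\<close> up to the factor 1/t, and this beats the power with the larger exponent
  \<open>s\<close>.\<close>

lemma step_dense_evenly:
  fixes K :: "'a::euclidean_space set"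
  assumes K: "compact K" "K \<noteq> {}" and s: "lower_box_dim K < ereal s"
  shows "step_dense K (evenly K m s)"
proof (rule step_denseI)
  fix M :: nat and h :: "nat \<Rightarrow> 'a" and e :: real
  assume M: "M > 0" "range h \<subseteq> K" "e > 0"
  obtain t :: nat where t: "t > 0" "\<forall>x\<in>K. \<forall>y\<in>K. norm (x - y) \<le> e * real t"
    using bounded_norm_diff_multiple[OF compact_imp_bounded[OF K(1)] M(3)] by blast
  obtain s' where s': "lower_box_dim K < ereal s'" "s' < s" using ereal_dense2[OF s] by auto
  have "frequently (\<lambda>r. ereal (ln (real (covering_number K r)) / - ln r) < ereal s') (at_right 0)"
    using s'(1) unfolding lower_box_dim_def by (rule frequently_lt_of_Liminf)
  \<comment> \<open>The 4 is 2 * 2: one doubling from moving the centres into \<open>K\<close>, one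
    built into \<open>evenly\<close>. The factor \<open>t\<close> is the loss in
    \<open>add_uniform_atoms\<close>.\<close>
  moreover have "eventually (\<lambda>r. (4 powr s * t) * r powr s < 1 * r powr s') (at_right 0)"
    using t(1) s'(2) by (intro eventually_powr_less) auto
  \<comment> \<open>The net is built at scale \<open>2 * r\<close>, and this scale has to be below
    1/(m+1).\<close>
  moreover have "eventually (\<lambda>r::real. 0 < r \<and> r < 1 / (2 * Suc m)) (at_right 0)"
    by (rule eventually_at_right_lt) simp
  ultimately have "frequently (\<lambda>r. ereal (ln (real (covering_number K r)) / - ln r) < ereal s' \<and>
    (4 powr s * t) * r powr s < 1 * r powr s' \<and> 0 < r \<and> r < 1 / (2 * Suc m)) (at_right 0)"
    using frequently_eventually_frequently eventually_conj by fast
  from frequently_ex[OF this] obtain r where r: "ln (real (covering_number K r)) / - ln r < s'"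
     "(4 powr s * t) * r powr s < r powr s'" "0 < r" "r < 1 / (2 * Suc m)"
    by auto
  have r1: "r < 1" using r(4) by (rule less_trans) (simp add: field_simps)
  define N where "N = covering_number K r"
  have N: "N > 0" using covering_number_pos[OF K(1) order_refl r(3) K(2)] by (simp add: N_def)
  have Nr: "real N < r powr - s'"
    using r(1) ln_div_minus_ln_iff(1)[of r "real N" s'] r(3) r1 N by (simp add: N_def)
  obtain C0 where C0: "finite C0" "card C0 = N" "K \<subseteq> (\<Union>x\<in>C0. ball x r)"
    using covering_number_witness[OF K(1) order_refl r(3)] by (auto simp: N_def)
  \<comment> \<open>The centres of an optimal cover may lie outside \<open>K\<close>, but new atoms
    may not. Balls that meet \<open>K\<close> are recentred at a point of \<open>K\<close>, with
    doubled radius and no more centres than before.\<close>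
  define C1 where "C1 = {c \<in> C0. ball c r \<inter> K \<noteq> {}}"
  have "\<forall>c\<in>C1. \<exists>y. y \<in> ball c r \<inter> K" by (auto simp: C1_def)
  from bchoice[OF this] obtain p where p: "\<forall>c\<in>C1. p c \<in> ball c r \<inter> K" by (rule exE)
  define C where "C = p ` C1"
  have "finite C1" "C1 \<subseteq> C0" using C0(1) by (auto simp: C1_def)
  then have cC: "card C \<le> N"
    using card_image_le[of C1 p] card_mono[of C0 C1] C0(1,2) by (simp add: C_def)
  have "x \<in> (\<Union>c\<in>C. ball c (2 * r))" if "x \<in> K" for x
  proof -
    obtain c where c: "c \<in> C0" "x \<in> ball c r" using C0(3) \<open>x \<in> K\<close> by blast
    then have c1: "c \<in> C1" using \<open>x \<in> K\<close> by (auto simp: C1_def)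
    have "dist (p c) x \<le> dist c (p c) + dist c x" by (rule dist_triangle3)
    also have "\<dots> < 2 * r" using bspec[OF p c1] c(2) by simp
    finally have "x \<in> ball (p c) (2 * r)" by simp
    then show ?thesis unfolding C_def using c1 by blast
  qed
  moreover have "C \<subseteq> K" using p by (auto simp: C_def)
  ultimately have net: "net K (2 * r) C" using \<open>finite C1\<close> unfolding net_def C_def by blast
  have C': "finite C" "C \<noteq> {}" "C \<subseteq> K" using net net_nonempty[OF net K(2)] by (simp_all add: net_def)
  obtain n H where H: "close_split K e M h n H"
    "\<forall>c\<in>C. \<forall>A\<in>sets borel. c \<in> A \<longrightarrow> 1 / (real (card C) * real t) \<le> measure (split_law M n H) A"
    using add_uniform_atoms[OF t M(1,2) C'] by blast
  have pos: "card C > 0" using C' by (simp add: card_gt_0_iff)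
  have "(2 * (2 * r)) powr s < measure (split_law M n H) (ball c (2 * r))" if "c \<in> C" for c
  proof -
    have "(2 * (2 * r)) powr s * t = (4 powr s * t) * r powr s" using r(3) by (simp add: powr_mult)
    also have "\<dots> < r powr s'" by (fact r(2))
    also have "\<dots> = 1 / r powr - s'" by (simp add: powr_minus_divide)
    also have "\<dots> \<le> 1 / real N" using Nr N r(3) by (intro divide_left_mono) auto
    also have "\<dots> \<le> 1 / real (card C)" using cC pos N by (intro divide_left_mono) auto
    finally have "(2 * (2 * r)) powr s < 1 / (real (card C) * real t)" using t(1) pos by (simp add: field_simps)
    also have "\<dots> \<le> measure (split_law M n H) (ball c (2 * r))" using H(2) that r(3) by simp
    finally show ?thesis .
  qed
  moreover have "split_law M n H \<in> prob_measures_on K"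
    using H(1) K(1) by (intro split_law_in_prob_measures_on) (auto simp: close_split_def compact_imp_closed)
  ultimately have "split_law M n H \<in> ball_gt K C (2 * r) ((2 * (2 * r)) powr s)" by (simp add: ball_gt_def)
  then have "split_law M n H \<in> evenly K m s"
    unfolding evenly_def using r(3,4) net by (intro UN_I[of "(C, 2 * r)"]) (auto simp: field_simps)
  with H(1) show "\<exists>n H. close_split K e M h n H \<and> split_law M n H \<in> evenly K m s"
    by blast
qed

text \<open>The list in the definition of the dimension is taken to be the values of the step map
  and \<open>r0\<close> to be \<open>e\<close>. One radius then gives at least
  \<open>r powr - s'\<close> points of separation \<open>r\<close> near every value, each within
  distance \<open>e\<close>, so all pieces may move there. A small ball catches at most one piece of
  each step, hence at most 1/n of the total mass.\<close>

lemma step_dense_spread: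
  fixes K :: "'a::euclidean_space set"
  assumes K: "compact K" "K \<noteq> {}" and s: "ereal s < upper_box_dim_loc_unif K"
  shows "step_dense K (spread K m s)"
proof (rule step_denseI)
  fix M :: nat and h :: "nat \<Rightarrow> 'a" and e :: real
  assume M: "M > 0" "range h \<subseteq> K" "e > 0"
  have hK: "h i \<in> K" for i using M(2) by auto
  obtain s' where s': "s < s'" "ereal s' < upper_box_dim_loc_unif K" using ereal_dense2[OF s] by auto
  define xs where "xs = map h [0..<M]"
  have xs: "length xs = M" "\<And>i. i < M \<Longrightarrow> xs ! i = h i" "xs \<noteq> []" "set xs \<subseteq> K"
    using M by (auto simp: xs_def)
  define N where "N i r = covering_number (K \<inter> ball (h i) e) r" for i r
  define m' where "m' r = Min ((\<lambda>i. ereal (ln (real (covering_number (K \<inter> ball (xs ! i) e) r)) / - ln r)) ` {..<length xs})" for r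
  have "upper_box_dim_loc_unif K \<le> Limsup (at_right 0) m'"
    unfolding upper_box_dim_loc_unif_def m'_def using xs(3,4) M(3)
    by (intro INF_lower2[of xs] INF_lower2[of e]) auto
  with s'(2) have "ereal s' < Limsup (at_right 0) m'" by simp
  then have "frequently (\<lambda>r. ereal s' < m' r) (at_right 0)" by (rule frequently_gt_of_Limsup)
  moreover have "eventually (\<lambda>r. (5 powr s) * r powr s' < 1 * r powr s) (at_right 0)"
    using s'(1) by (intro eventually_powr_less) auto
  moreover have "eventually (\<lambda>r::real. 0 < r \<and> r < 1 / Suc m) (at_right 0)"
    by (rule eventually_at_right_lt) simp
  ultimately have "frequently (\<lambda>r. ereal s' < m' r \<and>
    (5 powr s) * r powr s' < 1 * r powr s \<and> 0 < r \<and> r < 1 / Suc m) (at_right 0)"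
    using frequently_eventually_frequently eventually_conj by fast
  from frequently_ex[OF this] obtain r where r: "ereal s' < m' r" "(5 powr s) * r powr s' < r powr s" "0 < r" "r < 1 / Suc m"
    by auto
  have "1 / real (Suc m) \<le> 1" by simp
  with r(4) have r1: "r < 1" by linarith
  \<comment> \<open>The same number of pieces for all steps. It does not exceed any of the covering
    numbers, because these are integers above \<open>r powr - s'\<close>.\<close>
  define n where "n = nat \<lceil>r powr - s'\<rceil>"
  have n: "n > 0" "r powr - s' \<le> real n" using r(3) by (auto simp: n_def zero_less_ceiling)
  have nN: "n \<le> N i r" if "i < M" for i
  proof -
    have "ereal s' < ereal (ln (real (N i r)) / - ln r)"
    proof -
      have "m' r \<le> ereal (ln (real (covering_number (K \<inter> ball (xs ! i) e) r)) / - ln r)"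
        unfolding m'_def using that xs(1) by (intro Min_le) auto
      with r(1) have "ereal s' < ereal (ln (real (covering_number (K \<inter> ball (xs ! i) e) r)) / - ln r)"
        by (rule less_le_trans)
      then show ?thesis using xs(2)[OF that] by (simp add: N_def)
    qed
    moreover have "K \<inter> ball (h i) e \<noteq> {}" using hK[of i] M(3) centre_in_ball[of "h i" e] by blast
    then have "N i r > 0"
      unfolding N_def using covering_number_pos[OF K(1)] r(3) by blast
    ultimately have "r powr - s' < real (N i r)"
      using ln_div_minus_ln_iff(2)[of r "real (N i r)" s'] r(3) r1 by simp
    then show ?thesis unfolding n_def by linarith
  qed
  have "\<forall>i. \<exists>f. i < M \<longrightarrow> (\<forall>j<n. f j \<in> K \<inter> ball (h i) e) \<and> (\<forall>j<n. \<forall>k<n. j \<noteq> k \<longrightarrow> r \<le> dist (f j) (f k))"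
  proof
    fix i
    show "\<exists>f. i < M \<longrightarrow> (\<forall>j<n. f j \<in> K \<inter> ball (h i) e) \<and> (\<forall>j<n. \<forall>k<n. j \<noteq> k \<longrightarrow> r \<le> dist (f j) (f k))"
      using separated_points[of n "K \<inter> ball (h i) e" r] nN[of i] by (cases "i < M") (simp_all add: N_def)
  qed
  from choice[OF this] obtain f where f': "\<forall>i. i < M \<longrightarrow> (\<forall>j<n. f i j \<in> K \<inter> ball (h i) e) \<and>
      (\<forall>j<n. \<forall>k<n. j \<noteq> k \<longrightarrow> r \<le> dist (f i j) (f i k))"
    by (rule exE)
  then have f: "\<And>i j. i < M \<Longrightarrow> j < n \<Longrightarrow> f i j \<in> K \<inter> ball (h i) e"
    "\<And>i j k. i < M \<Longrightarrow> j < n \<Longrightarrow> k < n \<Longrightarrow> j \<noteq> k \<Longrightarrow> r \<le> dist (f i j) (f i k)"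
    by blast+
  define H where "H i j = (if i < M \<and> j < n then f i j else h i)" for i j
  have HK: "H i j \<in> K" for i j using hK f(1) by (auto simp: H_def)
  have "(\<Sum>i<M. \<Sum>j<n. norm (h i - H i j)) \<le> (\<Sum>i<M. \<Sum>j<n. e)"
    using f(1) by (intro sum_mono) (auto simp: H_def dist_norm less_imp_le)
  then have close: "(\<Sum>i<M. \<Sum>j<n. norm (h i - H i j)) \<le> e * real (M * n)" by (simp add: mult_ac)
  \<comment> \<open>A closed ball of radius 2r/5 has diameter at most 4r/5, less than the separation
    \<open>r\<close>. This is why the scale entering \<open>spread\<close> is r/5, and where the
    constant \<open>5 powr s\<close> above comes from.\<close>
  obtain C where net: "net K (r / 5) C" using compact_imp_net[OF K(1), of "r / 5"] r(3) by auto
  have "measure (split_law M n H) (cball c (2 * (r / 5))) < (r / 5) powr s" for c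
  proof -
    have "(\<Sum>j<n. indicator (cball c (2 * (r / 5))) (H i j) :: real) \<le> 1" if i: "i < M" for i
    proof -
      define J where "J = {j. j < n \<and> H i j \<in> cball c (2 * (r / 5))}"
      have inj: "j = k" if "j \<in> J" "k \<in> J" for j k
      proof (rule ccontr)
        assume "j \<noteq> k"
        then have "r \<le> dist (H i j) (H i k)" using that i f(2)[of i j k] by (auto simp: J_def H_def)
        also have "\<dots> \<le> dist c (H i j) + dist c (H i k)" by (rule dist_triangle3)
        also have "\<dots> \<le> 2 * (r / 5) + 2 * (r / 5)" using that by (intro add_mono) (auto simp: J_def)
        finally show False using r(3) by simp
      qed
      have "finite J" by (simp add: J_def)
      then have "card J \<le> 1" using inj card_le_Suc0_iff_eq[of J] unfolding One_nat_def by blast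
      moreover have "(\<Sum>j<n. indicator (cball c (2 * (r / 5))) (H i j) :: real) = real (card J)"
        by (simp add: indicator_def sum.If_cases J_def lessThan_def Collect_conj_eq)
      ultimately show ?thesis by simp
    qed
    then have "(\<Sum>i<M. \<Sum>j<n. indicator (cball c (2 * (r / 5))) (H i j) :: real) \<le> (\<Sum>i<M. 1)"
      by (intro sum_mono) auto
    then have "measure (split_law M n H) (cball c (2 * (r / 5))) \<le> (\<Sum>i<M. 1) / real (M * n)"
      unfolding measure_split_law[OF M(1) n(1) borel_closed[OF closed_cball]] by (intro divide_right_mono) auto
    also have "\<dots> = 1 / real n" using M(1) by simp
    also have "\<dots> \<le> 1 / r powr - s'" using n r(3) by (intro divide_left_mono) auto
    also have "\<dots> = r powr s'" by (simp add: powr_minus_divide)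
    also have "\<dots> < r powr s / 5 powr s" using r(2) by (simp add: field_simps)
    also have "\<dots> = (r / 5) powr s" using r(3) by (simp add: powr_divide)
    finally show ?thesis .
  qed
  moreover have "split_law M n H \<in> prob_measures_on K"
    using HK K(1) by (intro split_law_in_prob_measures_on compact_imp_closed)
  ultimately have "split_law M n H \<in> cball_lt K C (2 * (r / 5)) ((r / 5) powr s)" by (simp add: cball_lt_def)
  then have "split_law M n H \<in> spread K m s"
    unfolding spread_def using r(3,4) net by (intro UN_I[of "(C, r / 5)"]) auto
  moreover have "close_split K e M h n H" using close n(1) HK by (simp add: close_split_def)
  ultimately show "\<exists>n H. close_split K e M h n H \<and> split_law M n H \<in> spread K m s"
    by blast
qed

subsection \<open>Measures of full support\<close>

text \<open>The first inclusion carries lower bounds on mass from a net centre to nearby points, the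
  second carries upper bounds.\<close>

lemma net_ball_subset:
  assumes "dist c x < r"
  shows "ball c r \<subseteq> ball x (2 * r)" "ball x r \<subseteq> cball c (2 * r)"
proof -
  show "ball c r \<subseteq> ball x (2 * r)"
  proof
    fix y assume "y \<in> ball c r"
    then show "y \<in> ball x (2 * r)" using assms dist_triangle3[of x y c] by simp
  qed
  show "ball x r \<subseteq> cball c (2 * r)"
  proof
    fix y assume "y \<in> ball x r"
    then show "y \<in> cball c (2 * r)" using assms dist_triangle[of c y x] by simp
  qed
qed

lemma net_dist: "net K r C \<Longrightarrow> x \<in> K \<Longrightarrow> \<exists>c\<in>C. dist c x < r"
  by (auto simp: net_def subset_eq)

section \<open>From bounds at small radii to lower and upper limits\<close>

lemma ereal_le_if_real_below:
  fixes a b :: ereal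
  assumes "\<And>s. ereal s < a \<Longrightarrow> ereal s \<le> b"
  shows "a \<le> b"
proof (rule ccontr)
  assume "\<not> a \<le> b"
  then have "b < a" by simp
  from ereal_dense2[OF this] obtain s where "b < ereal s" "ereal s < a" by blast
  with assms[of s] show False by simp
qed

lemma ereal_le_if_real_above:
  fixes a b :: ereal
  assumes "\<And>s. b < ereal s \<Longrightarrow> a \<le> ereal s"
  shows "a \<le> b"
proof (rule ccontr)
  assume "\<not> a \<le> b"
  then have "b < a" by simp
  from ereal_dense2[OF this] obtain s where "b < ereal s" "ereal s < a" by blast
  with assms[of s] show False by simp
qed

text \<open>Covering arguments bound ball masses at r/2 or 2r when the covering number is taken at
  \<open>r\<close>; this reparametrises the result.\<close>

lemma eventually_at_right_double:
  assumes "eventually P (at_right (0::real))"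
  shows "eventually (\<lambda>r. P (r / 2)) (at_right 0)" "eventually (\<lambda>r. P (2 * r)) (at_right 0)"
proof -
  obtain b where b: "b > 0" "\<And>r. 0 < r \<Longrightarrow> r < b \<Longrightarrow> P r"
    using assms by (auto simp: eventually_at_right_field)
  show "eventually (\<lambda>r. P (r / 2)) (at_right 0)"
    using eventually_at_right_lt[of "2 * b"] b by (auto elim: eventually_mono)
  show "eventually (\<lambda>r. P (2 * r)) (at_right 0)"
    using eventually_at_right_lt[of "b / 2"] b by (auto elim: eventually_mono)
qed

lemma Liminf_le_of_arbitrarily_small:
  fixes f :: "real \<Rightarrow> ereal"
  assumes "\<And>m. \<exists>r. 0 < r \<and> r < 1 / Suc m \<and> f r \<le> c"
  shows "Liminf (at_right 0) f \<le> c"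
proof (rule ccontr)
  assume "\<not> Liminf (at_right 0) f \<le> c"
  then have "eventually (\<lambda>r. c < f r) (at_right 0)" by (intro less_LiminfD) (simp add: not_le)
  then obtain b where b: "b > 0" "\<And>r. 0 < r \<Longrightarrow> r < b \<Longrightarrow> c < f r"
    by (auto simp: eventually_at_right_field)
  obtain m :: nat where "1 / Suc m < b" using nat_approx_posE[OF b(1)] by blast
  with assms[of m] b(2) show False by (meson less_trans not_le)
qed

lemma Limsup_ge_of_arbitrarily_small:
  fixes f :: "real \<Rightarrow> ereal"
  assumes "\<And>m. \<exists>r. 0 < r \<and> r < 1 / Suc m \<and> c \<le> f r"
  shows "c \<le> Limsup (at_right 0) f"
proof (rule ccontr)
  assume "\<not> c \<le> Limsup (at_right 0) f"
  then have "eventually (\<lambda>r. f r < c) (at_right 0)" by (intro Limsup_lessD) (simp add: not_le)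
  then obtain b where b: "b > 0" "\<And>r. 0 < r \<Longrightarrow> r < b \<Longrightarrow> f r < c"
    by (auto simp: eventually_at_right_field)
  obtain m :: nat where "1 / Suc m < b" using nat_approx_posE[OF b(1)] by blast
  with assms[of m] b(2) show False by (meson less_trans not_le)
qed

section \<open>Dimension estimates for a measure with support \<open>K\<close>\<close>

locale full_support_measure =
  fixes K :: "'a::euclidean_space set" and \<mu> :: "'a measure"
  assumes K: "compact K" "K \<noteq> {}" and \<mu>: "\<mu> \<in> prob_measures_on K"
    and full: "\<And>m. \<mu> \<in> full_supp K m"
begin

sublocale prob_space \<mu>
  using prob_measures_onD[OF \<mu>] by simp

lemma sets_\<mu> [simp, measurable_cong]: "sets \<mu> = sets borel"
  and space_\<mu> [simp]: "space \<mu> = UNIV"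
  using prob_measures_onD[OF \<mu>] by simp_all

lemma measure_ball_mono: "A \<subseteq> B \<Longrightarrow> B \<in> sets borel \<Longrightarrow> measure \<mu> A \<le> measure \<mu> B"
  by (intro finite_measure_mono) auto

text \<open>A positive bound is needed below because \<open>ln 0 = 0\<close>: a vanishing infimum would destroy the
  equivalences \<open>ln_div_ln_iff\<close>.\<close>

lemma inf_ball_lower_bound:
  assumes "r > 0"
  shows "\<exists>c>0. \<forall>x\<in>K. c \<le> measure \<mu> (ball x r)"
proof -
  \<comment> \<open>Half of \<open>r\<close>, because a net ball is only contained in the ball of
    twice its radius around a nearby point.\<close>
  obtain m :: nat where m: "1 / Suc m < r / 2"
    using nat_approx_posE[of "r / 2"] assms by auto
  obtain C where C: "net K (1 / Suc m) C" "\<forall>c\<in>C. 0 < measure \<mu> (ball c (1 / Suc m))"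
    using full[of m] by (auto simp: full_supp_def ball_gt_def)
  define d where "d = Min ((\<lambda>c. measure \<mu> (ball c (1 / Suc m))) ` C)"
  have fin: "finite C" "C \<noteq> {}" using C(1) K(2) net_nonempty by (auto simp: net_def)
  have "d > 0" using fin C(2) by (simp add: d_def)
  moreover have "d \<le> measure \<mu> (ball x r)" if "x \<in> K" for x
  proof -
    obtain c where c: "c \<in> C" "dist c x < 1 / Suc m" using net_dist[OF C(1) \<open>x \<in> K\<close>] by blast
    have "d \<le> measure \<mu> (ball c (1 / Suc m))" using c(1) fin(1) by (simp add: d_def)
    also have "\<dots> \<le> measure \<mu> (ball x (2 * (1 / Suc m)))"
      by (rule measure_ball_mono[OF net_ball_subset(1)[OF c(2)]]) simp
    also have "\<dots> \<le> measure \<mu> (ball x r)"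
      using m by (intro measure_ball_mono subset_ball) auto
    finally show ?thesis .
  qed
  ultimately show ?thesis by blast
qed

lemma measure_ball_pos: "x \<in> K \<Longrightarrow> r > 0 \<Longrightarrow> 0 < measure \<mu> (ball x r)"
  using inf_ball_lower_bound[of r] by force

text \<open>With this the infima and suprema over \<open>msupp\<close> in the four dimensions run
  over the fixed set \<open>K\<close>.\<close>

lemma msupp_eq: "msupp \<mu> = K"
proof
  show "K \<subseteq> msupp \<mu>"
    using measure_ball_pos by (auto simp: msupp_def emeasure_eq_measure)
  show "msupp \<mu> \<subseteq> K"
  proof
    fix x assume x: "x \<in> msupp \<mu>"
    show "x \<in> K"
    proof (rule ccontr)
      assume "x \<notin> K"
      then have "x \<in> - K" "open (- K)" using K(1) by (auto simp: compact_imp_closed)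
      then obtain r where r: "r > 0" "ball x r \<subseteq> - K" by (meson open_contains_ball)
      have "K \<in> sets borel" using K(1) by (simp add: borel_compact)
      then have "measure \<mu> (- K) = 0"
        using prob_compl[of K] prob_measures_onD(4)[OF \<mu>] by (simp add: emeasure_eq_measure Compl_eq_Diff_UNIV)
      then have "measure \<mu> (ball x r) \<le> 0"
        using measure_ball_mono[OF r(2)] \<open>K \<in> sets borel\<close> by simp
      moreover have "0 < emeasure \<mu> (ball x r)" using x r(1) by (auto simp: msupp_def)
      ultimately show False by (simp add: emeasure_eq_measure)
    qed
  qed
qed

definition inf_ball :: "real \<Rightarrow> real" where
  "inf_ball r = (INF x\<in>K. measure \<mu> (ball x r))"

definition sup_ball :: "real \<Rightarrow> real" where
  "sup_ball r = (SUP x\<in>K. measure \<mu> (ball x r))"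

lemma inf_ball_le: "x \<in> K \<Longrightarrow> inf_ball r \<le> measure \<mu> (ball x r)"
  unfolding inf_ball_def by (intro cINF_lower bdd_belowI2[of _ 0]) auto

lemma inf_ball_ge: "(\<And>x. x \<in> K \<Longrightarrow> c \<le> measure \<mu> (ball x r)) \<Longrightarrow> c \<le> inf_ball r"
  unfolding inf_ball_def using K(2) by (intro cINF_greatest) auto

lemma sup_ball_ge: "x \<in> K \<Longrightarrow> measure \<mu> (ball x r) \<le> sup_ball r"
  unfolding sup_ball_def by (intro cSUP_upper bdd_aboveI2[of _ _ 1]) auto

lemma sup_ball_le: "(\<And>x. x \<in> K \<Longrightarrow> measure \<mu> (ball x r) \<le> c) \<Longrightarrow> sup_ball r \<le> c"
  unfolding sup_ball_def using K(2) by (intro cSUP_least) auto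

lemma inf_ball_pos: "r > 0 \<Longrightarrow> 0 < inf_ball r"
  using inf_ball_lower_bound[of r] inf_ball_ge by (meson less_le_trans)

lemma sup_ball_pos: "r > 0 \<Longrightarrow> 0 < sup_ball r"
  using K(2) measure_ball_pos sup_ball_ge by (meson all_not_in_conv less_le_trans)

lemma D_eqs:
  "lower_Dplus \<mu> = Liminf (at_right 0) (\<lambda>r. ereal (ln (sup_ball r) / ln r))"
  "upper_Dplus \<mu> = Limsup (at_right 0) (\<lambda>r. ereal (ln (sup_ball r) / ln r))"
  "lower_Dminus \<mu> = Liminf (at_right 0) (\<lambda>r. ereal (ln (inf_ball r) / ln r))"
  "upper_Dminus \<mu> = Limsup (at_right 0) (\<lambda>r. ereal (ln (inf_ball r) / ln r))"
  by (simp_all add: lower_Dplus_def upper_Dplus_def lower_Dminus_def upper_Dminus_def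
      sup_ball_def inf_ball_def msupp_eq)

lemma lower_Dplus_nonneg: "0 \<le> lower_Dplus \<mu>"
  unfolding D_eqs
proof (rule Liminf_bounded)
  show "eventually (\<lambda>r. 0 \<le> ereal (ln (sup_ball r) / ln r)) (at_right 0)"
    using eventually_at_right_lt[of 1, simplified]
  proof eventually_elim
    case (elim r)
    have "sup_ball r \<le> r powr 0" using elim by (simp add: sup_ball_le)
    then show ?case using ln_div_ln_iff(2)[of r "sup_ball r" 0] elim sup_ball_pos[of r] by simp
  qed
qed

lemma lower_Dplus_eq_0:
  assumes "\<And>m. \<mu> \<in> big_ball K m"
  shows "lower_Dplus \<mu> = 0"
proof (rule antisym[OF _ lower_Dplus_nonneg])
  show "lower_Dplus \<mu> \<le> 0"
  proof (rule ereal_le_if_real_above)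
    fix e :: real assume "0 < ereal e"
    then have e: "e > 0" by simp
    show "lower_Dplus \<mu> \<le> ereal e"
      unfolding D_eqs
    proof (rule Liminf_le_of_arbitrarily_small)
      fix m
      obtain k :: nat where k: "1 / Suc k < e" using nat_approx_posE[OF e] by blast
      \<comment> \<open>The index \<open>m\<close> makes the radius small enough and
        \<open>k\<close> brings the exponent 1/(j+1) below \<open>e\<close>.\<close>
      define j where "j = max m k"
      obtain y r where r: "y \<in> K" "0 < r" "r < 1 / Suc j" "r powr (1 / Suc j) < measure \<mu> (ball y r)"
        using assms[of j] by (auto simp: big_ball_def ball_gt_def)
      have jm: "1 / real (Suc j) \<le> 1 / real (Suc m)" "1 / real (Suc j) \<le> 1 / real (Suc k)" "1 / real (Suc j) \<le> 1"
        by (auto simp: j_def intro!: divide_left_mono)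
      have r': "r < 1" "r < 1 / Suc m" "1 / real (Suc j) \<le> e" using r(3) jm k by linarith+
      have "r powr e \<le> r powr (1 / Suc j)" using r(2) r' by (intro powr_mono') auto
      also have "\<dots> \<le> sup_ball r" using r(4) sup_ball_ge[OF r(1), of r] by linarith
      finally have "ln (sup_ball r) / ln r \<le> e"
        using ln_div_ln_iff(1)[of r "sup_ball r" e] r(2) r'(1) sup_ball_pos[OF r(2)] by simp
      then show "\<exists>r. 0 < r \<and> r < 1 / Suc m \<and> ereal (ln (sup_ball r) / ln r) \<le> ereal e"
        using r(2) r'(2) by (intro exI[of _ r]) simp
    qed
  qed
qed

lemma upper_Dminus_eq_infinity:
  assumes "\<And>m. \<mu> \<in> small_ball K m"
  shows "upper_Dminus \<mu> = \<infinity>"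
proof (rule ereal_top)
  fix B :: real
  show "ereal B \<le> upper_Dminus \<mu>"
    unfolding D_eqs
  proof (rule Limsup_ge_of_arbitrarily_small)
    fix m
    \<comment> \<open>Again one index serves two purposes: radius below 1/(m+1) and exponent at
      least \<open>B\<close>.\<close>
    define j where "j = max m (nat \<lceil>B\<rceil>)"
    obtain y r where r: "y \<in> K" "0 < r" "r < 1 / Suc j" "measure \<mu> (cball y r) < r powr j"
      using assms[of j] by (auto simp: small_ball_def cball_lt_def)
    have jm: "1 / real (Suc j) \<le> 1 / real (Suc m)" "1 / real (Suc j) \<le> 1"
      by (auto simp: j_def intro!: divide_left_mono)
    have r': "r < 1" "r < 1 / Suc m" using r(3) jm by linarith+
    have "B \<le> real j" unfolding j_def by linarith
    have "inf_ball r \<le> measure \<mu> (ball y r)" using r(1) by (rule inf_ball_le)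
    also have "\<dots> \<le> measure \<mu> (cball y r)" by (intro measure_ball_mono ball_subset_cball) simp
    also have "\<dots> \<le> r powr j" using r(4) by simp
    also have "\<dots> \<le> r powr B" using r(2) r'(1) \<open>B \<le> real j\<close> by (intro powr_mono') auto
    finally have "B \<le> ln (inf_ball r) / ln r"
      using ln_div_ln_iff(2)[of r "inf_ball r" B] r(2) r'(1) inf_ball_pos[OF r(2)] by simp
    then show "\<exists>r. 0 < r \<and> r < 1 / Suc m \<and> ereal B \<le> ereal (ln (inf_ball r) / ln r)"
      using r(2) r'(2) by (intro exI[of _ r]) simp
  qed
qed

lemma upper_Dplus_ge:
  assumes "\<And>m. \<mu> \<in> spread K m s"
  shows "ereal s \<le> upper_Dplus \<mu>"
  unfolding D_eqs
proof (rule Limsup_ge_of_arbitrarily_small)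
  fix m
  obtain C r where r: "0 < r" "r < 1 / Suc m" "net K r C" "\<And>c. c \<in> C \<Longrightarrow> measure \<mu> (cball c (2 * r)) < r powr s"
    using assms[of m] by (auto simp: spread_def cball_lt_def)
  have "1 / real (Suc m) \<le> 1" by simp
  then have r1: "r < 1" using r(2) by linarith
  have "sup_ball r \<le> r powr s"
  proof (rule sup_ball_le)
    fix x assume "x \<in> K"
    obtain c where c: "c \<in> C" "dist c x < r" using net_dist[OF r(3) \<open>x \<in> K\<close>] by blast
    have "measure \<mu> (ball x r) \<le> measure \<mu> (cball c (2 * r))"
      by (rule measure_ball_mono[OF net_ball_subset(2)[OF c(2)]]) simp
    then show "measure \<mu> (ball x r) \<le> r powr s" using r(4)[OF c(1)] by linarith
  qed
  then have "s \<le> ln (sup_ball r) / ln r"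
    using ln_div_ln_iff(2)[of r "sup_ball r" s] r(1) r1 sup_ball_pos[OF r(1)] by simp
  then show "\<exists>r. 0 < r \<and> r < 1 / Suc m \<and> ereal s \<le> ereal (ln (sup_ball r) / ln r)"
    using r(1,2) by (intro exI[of _ r]) auto
qed

lemma lower_Dminus_le:
  assumes "\<And>m. \<mu> \<in> evenly K m s"
  shows "lower_Dminus \<mu> \<le> ereal s"
  unfolding D_eqs
proof (rule Liminf_le_of_arbitrarily_small)
  fix m
  \<comment> \<open>The index \<open>2 * m + 1\<close> gives radius below 1/(2m+2), so that
    \<open>2 * r\<close>, where the infimum is estimated, is below 1/(m+1).\<close>
  obtain C r where r: "0 < r" "r < 1 / Suc (2 * m + 1)" "net K r C" "\<And>c. c \<in> C \<Longrightarrow> (2 * r) powr s < measure \<mu> (ball c r)"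
    using assms[of "2 * m + 1"] by (auto simp: evenly_def ball_gt_def)
  have r2: "2 * r < 1 / Suc m" using r(2) by (simp add: field_simps)
  have "1 / real (Suc m) \<le> 1" by simp
  then have r1: "2 * r < 1" using r2 by linarith
  have "(2 * r) powr s \<le> inf_ball (2 * r)"
  proof (rule inf_ball_ge)
    fix x assume "x \<in> K"
    obtain c where c: "c \<in> C" "dist c x < r" using net_dist[OF r(3) \<open>x \<in> K\<close>] by blast
    have "measure \<mu> (ball c r) \<le> measure \<mu> (ball x (2 * r))"
      by (rule measure_ball_mono[OF net_ball_subset(1)[OF c(2)]]) simp
    then show "(2 * r) powr s \<le> measure \<mu> (ball x (2 * r))" using r(4)[OF c(1)] by linarith
  qed
  then have "ln (inf_ball (2 * r)) / ln (2 * r) \<le> s"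
    using ln_div_ln_iff(1)[of "2 * r" "inf_ball (2 * r)" s] r(1) r1 inf_ball_pos[of "2 * r"] by simp
  then show "\<exists>r. 0 < r \<and> r < 1 / Suc m \<and> ereal (ln (inf_ball r) / ln r) \<le> ereal s"
    using r(1) r2 by (intro exI[of _ "2 * r"]) auto
qed

lemma lower_box_dim_le_lower_Dminus: "lower_box_dim K \<le> lower_Dminus \<mu>"
proof (rule ereal_le_if_real_below)
  fix s' assume "ereal s' < lower_box_dim K"
  then obtain s where s: "s' < s" "ereal s < lower_box_dim K" using ereal_dense2[of "ereal s'" "lower_box_dim K"] by auto
  have "eventually (\<lambda>r. ereal s < ereal (ln (real (covering_number K r)) / - ln r)) (at_right 0)"
    using s(2) unfolding lower_box_dim_def by (rule less_LiminfD)
  \<comment> \<open>Points of separation \<open>r\<close> have disjoint balls of radius r/2 only;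
    the factor turns a bound by \<open>r powr s\<close> into one by
    \<open>(r / 2) powr s'\<close>.\<close>
  moreover have "eventually (\<lambda>r. 1 * r powr s < (1 / 2) powr s' * r powr s') (at_right 0)"
    using s(1) by (intro eventually_powr_less) auto
  moreover have "eventually (\<lambda>r::real. 0 < r \<and> r < 1) (at_right 0)" by (rule eventually_at_right_lt) simp
  ultimately have "eventually (\<lambda>r. s' \<le> ln (inf_ball (r / 2)) / ln (r / 2)) (at_right 0)"
  proof eventually_elim
    case (elim r)
    define N where "N = covering_number K r"
    have N: "N > 0" using covering_number_pos[OF K(1) order_refl _ K(2), of r] elim by (simp add: N_def)
    have "r powr - s < real N"
      using ln_div_minus_ln_iff(2)[of r "real N" s] elim N by (simp add: N_def)
    have "N \<le> covering_number K r" by (simp add: N_def)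
    from separated_points[OF this] obtain f where
      f': "(\<forall>j<N. f j \<in> K) \<and> (\<forall>j<N. \<forall>k<N. j \<noteq> k \<longrightarrow> r \<le> dist (f j) (f k))"
      by (rule exE)
    then have f: "\<And>j. j < N \<Longrightarrow> f j \<in> K" "\<And>j k. j < N \<Longrightarrow> k < N \<Longrightarrow> j \<noteq> k \<Longrightarrow> r \<le> dist (f j) (f k)"
      by blast+
    have disj: "disjoint_family_on (\<lambda>j. ball (f j) (r / 2)) {..<N}"
    proof (unfold disjoint_family_on_def, intro ballI impI)
      fix j k assume jk: "j \<in> {..<N}" "k \<in> {..<N}" "j \<noteq> k"
      have "False" if "y \<in> ball (f j) (r / 2)" "y \<in> ball (f k) (r / 2)" for y
      proof -
        have "r \<le> dist (f j) (f k)" using f(2) jk by simp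
        also have "\<dots> \<le> dist (f j) y + dist (f k) y" by (rule dist_triangle2)
        finally show False using that by simp
      qed
      then show "ball (f j) (r / 2) \<inter> ball (f k) (r / 2) = {}" by blast
    qed
    have "real N * inf_ball (r / 2) = (\<Sum>j<N. inf_ball (r / 2))" by simp
    also have "\<dots> \<le> (\<Sum>j<N. measure \<mu> (ball (f j) (r / 2)))"
      using f(1) by (intro sum_mono inf_ball_le) auto
    also have "\<dots> = measure \<mu> (\<Union>j<N. ball (f j) (r / 2))"
      using disj by (intro finite_measure_finite_Union[symmetric]) auto
    also have "\<dots> \<le> 1" by simp
    finally have "inf_ball (r / 2) \<le> 1 / real N" using N by (simp add: field_simps)
    also have "\<dots> \<le> 1 / r powr - s" using \<open>r powr - s < real N\<close> elim N by (intro divide_left_mono) auto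
    also have "\<dots> = r powr s" by (simp add: powr_minus_divide)
    also have "\<dots> \<le> (1 / 2) powr s' * r powr s'" using elim by simp
    also have "\<dots> = (r / 2) powr s'" using elim by (simp add: powr_mult[symmetric])
    finally show ?case
      using ln_div_ln_iff(2)[of "r / 2" "inf_ball (r / 2)" s'] elim inf_ball_pos[of "r / 2"] by simp
  qed
  then have "eventually (\<lambda>r. s' \<le> ln (inf_ball (2 * r / 2)) / ln (2 * r / 2)) (at_right 0)"
    by (rule eventually_at_right_double(2))
  then show "ereal s' \<le> lower_Dminus \<mu>"
    unfolding D_eqs by (intro Liminf_bounded) (auto elim: eventually_mono)
qed

lemma upper_Dplus_le_upper_box_dim_loc_unif: "upper_Dplus \<mu> \<le> upper_box_dim_loc_unif K"
  unfolding upper_box_dim_loc_unif_def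
proof (intro INF_greatest)
  fix xs and r0 :: real
  assume xs: "xs \<in> {xs. xs \<noteq> [] \<and> set xs \<subseteq> K}" and r0: "r0 \<in> {0<..}"
  define A where "A i = K \<inter> ball (xs ! i) r0" for i
  define m where "m r = Min ((\<lambda>i. ereal (ln (real (covering_number (A i) r)) / - ln r)) ` {..<length xs})" for r
  \<comment> \<open>The index that attains the minimum in \<open>m r\<close> may change with
    \<open>r\<close>. Taking the least mass over the whole list gives a constant independent of
    \<open>r\<close>.\<close>
  define c where "c = Min ((\<lambda>i. measure \<mu> (ball (xs ! i) r0)) ` {..<length xs})"
  have xK: "xs ! i \<in> K" if "i < length xs" for i using xs that by (auto dest: nth_mem)
  have ne: "{..<length xs} \<noteq> {}" using xs by auto
  have c: "c > 0" using xK measure_ball_pos r0 ne by (auto simp: c_def)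
  have K_ae: "measure \<mu> (A i) = measure \<mu> (ball (xs ! i) r0)" for i
  proof -
    have "AE x in \<mu>. x \<in> K"
      using K(1) prob_measures_onD(4)[OF \<mu>] by (intro AE_prob_1) (simp add: emeasure_eq_measure)
    then show ?thesis
      unfolding A_def using K(1) by (intro measure_eq_AE) (auto simp: borel_compact)
  qed
  have "upper_Dplus \<mu> \<le> Limsup (at_right 0) m"
  proof (rule ereal_le_if_real_above)
    fix s' assume "Limsup (at_right 0) m < ereal s'"
    then obtain s where s: "s < s'" "Limsup (at_right 0) m < ereal s" using ereal_dense2[of "Limsup (at_right 0) m" "ereal s'"] by auto
    have "eventually (\<lambda>r. m r < ereal s) (at_right 0)" using s(2) by (rule Limsup_lessD)
    \<comment> \<open>The pigeonhole argument yields at least \<open>c * r powr s\<close> for the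
      supremum at radius \<open>2 * r\<close>; this makes it exceed
      \<open>(2 * r) powr s'\<close>.\<close>
    moreover have "eventually (\<lambda>r. 2 powr s' * r powr s' < c * r powr s) (at_right 0)"
      using s(1) c by (intro eventually_powr_less) auto
    moreover have "eventually (\<lambda>r::real. 0 < r \<and> r < 1 / 2) (at_right 0)" by (rule eventually_at_right_lt) simp
    ultimately have "eventually (\<lambda>r. ln (sup_ball (2 * r)) / ln (2 * r) \<le> s') (at_right 0)"
    proof eventually_elim
      case (elim r)
      have "m r \<in> (\<lambda>i. ereal (ln (real (covering_number (A i) r)) / - ln r)) ` {..<length xs}"
        unfolding m_def using ne by (intro Min_in) auto
      then obtain i where i: "i < length xs" "m r = ereal (ln (real (covering_number (A i) r)) / - ln r)" by auto
      define N where "N = covering_number (A i) r"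
      have "A i \<noteq> {}" using xK[OF i(1)] r0 by (auto simp: A_def)
      then have N: "N > 0" using covering_number_pos[OF K(1), of "A i" r] elim by (simp add: N_def A_def)
      have "real N < r powr - s"
        using ln_div_minus_ln_iff(1)[of r "real N" s] elim N i(2) by (simp add: N_def)
      obtain C where C: "finite C" "card C = N" "A i \<subseteq> (\<Union>x\<in>C. ball x r)"
        using covering_number_witness[OF K(1), of "A i" r] elim by (auto simp: A_def N_def)
      \<comment> \<open>The centre \<open>x\<close> of a covering ball may lie outside
        \<open>K\<close>, where \<open>sup_ball\<close> says nothing. A point of \<open>K\<close> in
        the ball serves as new centre, at the price of doubling the radius.\<close>
      have sup: "measure \<mu> (ball x r \<inter> A i) \<le> sup_ball (2 * r)" for x
      proof (cases "ball x r \<inter> A i = {}")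
        case True
        then show ?thesis using sup_ball_pos[of "2 * r"] elim by simp
      next
        case False
        then obtain y where y: "y \<in> K" "dist x y < r" by (auto simp: A_def)
        have "measure \<mu> (ball x r \<inter> A i) \<le> measure \<mu> (ball y (2 * r))"
          using net_ball_subset(1)[OF y(2)] by (intro measure_ball_mono) auto
        also have "\<dots> \<le> sup_ball (2 * r)" using y(1) by (rule sup_ball_ge)
        finally show ?thesis .
      qed
      have AB: "A i \<in> sets borel" unfolding A_def using borel_compact[OF K(1)] by (intro sets.Int) simp_all
      have "c \<le> measure \<mu> (A i)" unfolding K_ae c_def using i(1) by (intro Min_le) auto
      also have "A i = (\<Union>x\<in>C. ball x r \<inter> A i)" using C(3) by auto
      also have "measure \<mu> (\<Union>x\<in>C. ball x r \<inter> A i) \<le> (\<Sum>x\<in>C. measure \<mu> (ball x r \<inter> A i))"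
        using C(1) AB by (intro measure_UNION_le) auto
      also have "\<dots> \<le> (\<Sum>x\<in>C. sup_ball (2 * r))" by (intro sum_mono sup)
      also have "\<dots> = real N * sup_ball (2 * r)" by (simp add: C(2))
      also have "\<dots> \<le> r powr - s * sup_ball (2 * r)"
        using \<open>real N < r powr - s\<close> sup_ball_pos[of "2 * r"] elim by (intro mult_right_mono) auto
      finally have "c * r powr s \<le> r powr s * r powr - s * sup_ball (2 * r)"
        by (simp add: mult.assoc mult.commute[of c] mult_left_mono)
      also have "r powr s * r powr - s = 1" using elim by (simp flip: powr_add)
      finally have "c * r powr s \<le> sup_ball (2 * r)" by simp
      moreover have "(2 * r) powr s' = 2 powr s' * r powr s'" using elim by (simp add: powr_mult)
      ultimately have "(2 * r) powr s' \<le> sup_ball (2 * r)" using elim by linarith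
      then show ?case
        using ln_div_ln_iff(1)[of "2 * r" "sup_ball (2 * r)" s'] elim sup_ball_pos[of "2 * r"] by simp
    qed
    then have "eventually (\<lambda>r. ln (sup_ball (2 * (r / 2))) / ln (2 * (r / 2)) \<le> s') (at_right 0)"
      by (rule eventually_at_right_double(1))
    then show "upper_Dplus \<mu> \<le> ereal s'"
      unfolding D_eqs by (intro Limsup_bounded) (auto elim: eventually_mono)
  qed
  then show "upper_Dplus \<mu> \<le> Limsup (at_right 0) (\<lambda>r. Min ((\<lambda>i. ereal (ln (real (covering_number (K \<inter> ball (xs ! i) r0) r)) / - ln r)) ` {..<length xs}))"
    unfolding m_def A_def .
qed

end

text \<open>Rational thresholds approximate the dimensions from either side, so countably many open
  conditions suffice.\<close>

lemma ereal_rat_between: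
  assumes "a < b"
  shows "\<exists>q\<in>\<rat>. a < ereal q \<and> ereal q < b"
proof -
  obtain u where u: "a < ereal u" "ereal u < b" using ereal_dense2[OF assms] by blast
  obtain v where v: "ereal u < ereal v" "ereal v < b" using ereal_dense2[OF u(2)] by blast
  obtain q where q: "q \<in> \<rat>" "u < q" "q < v" using Rats_dense_in_real[of u v] v(1) by auto
  have "a < ereal q" using u(1) q(2) by (meson less_trans less_ereal.simps(1))
  moreover have "ereal q < b" using v(2) q(3) by (meson less_trans less_ereal.simps(1))
  ultimately show ?thesis using q(1) by blast
qed

theorem theorem7p1:
  fixes K :: "'a::euclidean_space set"
  assumes "compact K" and "infinite K"
  shows "typical (weak_topology K)
           (\<lambda>\<mu>. lower_Dplus \<mu> = 0 \<and>
                 upper_Dplus \<mu> = upper_box_dim_loc_unif K \<and>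
                 lower_Dminus \<mu> = lower_box_dim K \<and>
                 upper_Dminus \<mu> = \<infinity>)"
proof -
  have K: "compact K" "K \<noteq> {}" using assms by auto
  \<comment> \<open>The inequality defining \<open>S\<close>, like the one defining
    \<open>T\<close>, is strict: \<open>step_dense_spread\<close> and
    \<open>step_dense_evenly\<close> need room for a second exponent between the threshold and the
    dimension.\<close>
  define S where "S = {s \<in> \<rat>. ereal s < upper_box_dim_loc_unif K}"
  define T where "T = {s \<in> \<rat>. lower_box_dim K < ereal s}"
  have count: "countable S" "countable T"
    unfolding S_def T_def by (auto intro: countable_subset[OF _ countable_rat])
  define \<U> where "\<U> = range (full_supp K) \<union> range (big_ball K) \<union> range (small_ball K) \<union>
    (\<lambda>(m, s). spread K m s) ` (UNIV \<times> S) \<union> (\<lambda>(m, s). evenly K m s) ` (UNIV \<times> T)"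
  show ?thesis
  proof (rule typicalI[OF K(1)])
    show "countable \<U>" unfolding \<U>_def using count by (intro countable_Un countable_image countable_SIGMA) auto
    show "\<U> \<noteq> {}" by (simp add: \<U>_def)
    show "openin (weak_topology K) U" if "U \<in> \<U>" for U
      using that unfolding \<U>_def
      by (auto intro: openin_full_supp openin_big_ball openin_small_ball openin_spread openin_evenly)
    show "step_dense K U" if "U \<in> \<U>" for U
      using that unfolding \<U>_def S_def T_def
      by (auto intro: step_dense_full_supp[OF K] step_dense_big_ball[OF K(1)] step_dense_small_ball[OF assms]
          step_dense_spread[OF K] step_dense_evenly[OF K])
    fix \<mu> assume "\<mu> \<in> \<Inter>\<U>"
    then have in_U: "\<mu> \<in> U" if "U \<in> \<U>" for U using that by blast
    have mem: "\<mu> \<in> full_supp K m" "\<mu> \<in> big_ball K m" "\<mu> \<in> small_ball K m"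
      "s \<in> S \<Longrightarrow> \<mu> \<in> spread K m s" "s \<in> T \<Longrightarrow> \<mu> \<in> evenly K m s" for m s
      by (rule in_U, force simp: \<U>_def)+
    have "\<mu> \<in> prob_measures_on K" using mem(1)[of 0] by (auto simp: full_supp_def ball_gt_def)
    then interpret full_support_measure K \<mu> by unfold_locales (use K mem(1) in auto)
    have "upper_box_dim_loc_unif K \<le> upper_Dplus \<mu>"
    proof (rule ereal_le_if_real_below)
      fix s assume "ereal s < upper_box_dim_loc_unif K"
      from ereal_rat_between[OF this] obtain q where q: "q \<in> S" "ereal s < ereal q" by (auto simp: S_def)
      show "ereal s \<le> upper_Dplus \<mu>"
        using upper_Dplus_ge[OF mem(4)[OF q(1)]] q(2) by (meson less_imp_le order_trans)
    qed
    moreover have "lower_Dminus \<mu> \<le> lower_box_dim K"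
    proof (rule ereal_le_if_real_above)
      fix s assume "lower_box_dim K < ereal s"
      from ereal_rat_between[OF this] obtain q where q: "q \<in> T" "ereal q < ereal s" by (auto simp: T_def)
      show "lower_Dminus \<mu> \<le> ereal s"
        using lower_Dminus_le[OF mem(5)[OF q(1)]] q(2) by (meson less_imp_le order_trans)
    qed
    ultimately show "lower_Dplus \<mu> = 0 \<and> upper_Dplus \<mu> = upper_box_dim_loc_unif K \<and>
        lower_Dminus \<mu> = lower_box_dim K \<and> upper_Dminus \<mu> = \<infinity>"
      using lower_Dplus_eq_0[OF mem(2)] upper_Dminus_eq_infinity[OF mem(3)]
        upper_Dplus_le_upper_box_dim_loc_unif lower_box_dim_le_lower_Dminus
      by (auto intro: antisym)
  qed
qed

end
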